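(* Let $\mathfrak A$ be a countable finitely homogeneous Ramsey structure and let $\mathfrak C$ be a reduct of $\mathfrak A$. Let $\mathscr C$ be the clone of all polymorphisms of $\mathfrak C$ that are canonical over $\mathfrak A$ and let $\zeta\colon\mathscr C\to\operatorname{Proj}$ be an $\overline{\operatorname{Aut}(\mathfrak A)}$-invariant minor-preserving map. Then the following are equivalent. (1) $\zeta$ has the unique interpolation property (UIP) with respect to $\operatorname{Pol}(\mathfrak C)$ over $\mathfrak A$. (2) For all binary $f\in\operatorname{Pol}(\mathfrak C)$ and $u_1,u_2\in\overline{\operatorname{Aut}(\mathfrak A)}$, if $f(\operatorname{id},u_1)$ and $f(\operatorname{id},u_2)$ are canonical over $\mathfrak A$, then $\zeta(f(\operatorname{id},u_1))=\zeta(f(\operatorname{id},u_2))$.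
   Context: All structures are relational. A structure is homogeneous if every isomorphism between finite substructures extends to an automorphism; finitely homogeneous means homogeneous with a finite relational signature. For structures $\mathfrak X,\mathfrak Y$ in the same signature, $\binom{\mathfrak Y}{\mathfrak X}$ is the set of embeddings of $\mathfrak X$ into $\mathfrak Y$; $\mathfrak Z\to(\mathfrak Y)^{\mathfrak X}_r$ means that for every $\chi\colon\binom{\mathfrak Z}{\mathfrak X}\to\{1,\dots,r\}$ there is $e\in\binom{\mathfrak Z}{\mathfrak Y}$ such that $\chi$ is constant on $\{e\circ f: f\in\binom{\mathfrak Y}{\mathfrak X}\}$. A homogeneous structure is Ramsey if its age $\mathcal K$ (the class of finite structures embedding into it) satisfies: for all $\mathfrak X,\mathfrak Y\in\mathcal K$, $r\in\mathbb N$ there is $\mathfrak Z\in\mathcal K$ with $\mathfrak Z\to(\mathfrak Y)^{\mathfrak X}_r$. $\operatorname{Pol}(\mathfrak C)$ is the clone of all homomorphisms from finite direct powers $\mathfrak C^k$ to $\mathfrak C$. $\operatorname{Proj}$ is the clone of all projections on $\{0,1\}$. $\operatorname{typ}^{\mathfrak A}(a)$ is the set of first-order formulas satisfied by the tuple $a$ in $\mathfrak A$. An operation $f\colon A^k\to A$ is canonical over $\mathfrak A$ if for all $n$ and $a_1,\dots,a_k,b_1,\dots,b_k\in A^n$ with $\operatorname{typ}^{\mathfrak A}(a_i)=\operatorname{typ}^{\mathfrak A}(b_i)$ for all $i$ we have $\operatorname{typ}^{\mathfrak A}(f(a_1,\dots,a_k))=\operatorname{typ}^{\mathfrak A}(f(b_1,\dots,b_k))$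 (componentwise application). $\overline{\operatorname{Aut}(\mathfrak A)}$ is the closure of $\operatorname{Aut}(\mathfrak A)$ in the set of maps $A\to A$ with respect to pointwise convergence (i.e. all maps agreeing on every finite set with some automorphism). For unary $v_1,\dots,v_k$, $f(v_1,\dots,v_k)$ denotes $(a_1,\dots,a_k)\mapsto f(v_1(a_1),\dots,v_k(a_k))$. For a set $\mathscr M$ of unary operations, $\zeta$ defined on $\mathscr C$ is $\mathscr M$-invariant if $\zeta(f)=\zeta(u(f(v_1,\dots,v_k)))$ for all $k$-ary $f\in\mathscr C$ and $u,v_1,\dots,v_k\in\mathscr M$. For $f$ of arity $n$ and $\alpha\colon\{1,\dots,n\}\to\{1,\dots,k\}$ let $f_\alpha(x_1,\dots,x_k)=f(x_{\alpha(1)},\dots,x_{\alpha(n)})$. An arity-preserving map $\zeta$ between clones is minor-preserving if $\zeta(f_\alpha)=\zeta(f)_\alpha$ for all such $f,\alpha$. $f\colon A^k\to A$ interpolates $g\colon A^k\to A$ over $\mathscr M$ if for every finite $F\subseteq A$ there are $u,v_1,\dots,v_k\in\mathscr M$ with $g(a_1,\dots,a_k)=u(f(v_1(a_1),\dots,v_k(a_k)))$ for all $a_1,\dots,a_k\in F$. For a clone $\mathscr P$ containing $\operatorname{Aut}(\mathfrak A)$, a function $\zeta$ defined on $\mathscr D\subseteq\mathscr P$ has the UIP with respect to $\mathscr P$ over $\mathfrak A$ if $\zeta(g)=\zeta(h)$ for all $g,h\in\mathscr D$ that are interpolated by the same operation $f\in\mathscr P$ over $\operatorname{Aut}(\mathfrak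 A)$. *)

theory Defs
  imports "HOL-Library.FuncSet" "HOL-Library.Countable"
begin

section \<open>Relational structures\<close>

text \<open>
  A signature is a partial map from relation symbols to arities, so that the empty signature is
  included.  The value of \<open>rel X r\<close> matters only for symbols \<open>r\<close> of the signature, and only on
  tuples over the domain that have the arity of \<open>r\<close>; every definition below ignores the rest.
\<close>

record ('r, 'a) struct =
  signat :: "'r \<rightharpoonup> nat"
  univ :: "'a set"
  rel :: "'r \<Rightarrow> 'a list set"

definition tuples :: "nat \<Rightarrow> 'a set \<Rightarrow> 'a list set" where
  "tuples n D = {xs. length xs = n \<and> set xs \<subseteq> D}"

definition homs :: "('r, 'a) struct \<Rightarrow> ('r, 'b) struct \<Rightarrow> ('a \<Rightarrow> 'b) set" where
  "homs X Y = {f \<in> univ X \<rightarrow>\<^sub>E univ Y. signat X = signat Y \<and>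
     (\<forall>r n. signat X r = Some n \<longrightarrow>
       (\<forall>xs \<in> tuples n (univ X). xs \<in> rel X r \<longrightarrow> map f xs \<in> rel Y r))}"

definition embeddings :: "('r, 'a) struct \<Rightarrow> ('r, 'b) struct \<Rightarrow> ('a \<Rightarrow> 'b) set" where
  "embeddings X Y = {f \<in> univ X \<rightarrow>\<^sub>E univ Y. signat X = signat Y \<and> inj_on f (univ X) \<and>
     (\<forall>r n. signat X r = Some n \<longrightarrow>
       (\<forall>xs \<in> tuples n (univ X). xs \<in> rel X r \<longleftrightarrow> map f xs \<in> rel Y r))}"

definition isos :: "('r, 'a) struct \<Rightarrow> ('r, 'b) struct \<Rightarrow> ('a \<Rightarrow> 'b) set" where
  "isos X Y = {f \<in> embeddings X Y. f ` univ X = univ Y}"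

definition Aut :: "('r, 'a) struct \<Rightarrow> ('a \<Rightarrow> 'a) set" where
  "Aut A = isos A A"

definition substructure :: "('r, 'a) struct \<Rightarrow> 'a set \<Rightarrow> ('r, 'a) struct" where
  "substructure A S = A\<lparr>univ := S\<rparr>"

definition homogeneous :: "('r, 'a) struct \<Rightarrow> bool" where
  "homogeneous A \<longleftrightarrow>
     (\<forall>S T f. finite S \<and> S \<subseteq> univ A \<and> T \<subseteq> univ A \<and>
        f \<in> isos (substructure A S) (substructure A T) \<longrightarrow>
        (\<exists>\<alpha> \<in> Aut A. \<forall>x \<in> S. \<alpha> x = f x))"

definition finitely_homogeneous :: "('r, 'a) struct \<Rightarrow> bool" where
  "finitely_homogeneous A \<longleftrightarrow> homogeneous A \<and> finite (dom (signat A))"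

section \<open>The Ramsey property\<close>

text \<open>
  Every finite structure is isomorphic to one whose domain is a set of natural numbers, so these
  represent the age.
\<close>

definition age :: "('r, 'a) struct \<Rightarrow> ('r, nat) struct set" where
  "age A = {X. finite (univ X) \<and> signat X = signat A \<and> embeddings X A \<noteq> {}}"

definition ramsey_arrow ::
  "('r, 'c) struct \<Rightarrow> ('r, 'b) struct \<Rightarrow> ('r, 'a) struct \<Rightarrow> nat \<Rightarrow> bool" where
  "ramsey_arrow Z Y X r \<longleftrightarrow>
     (\<forall>\<chi> \<in> embeddings X Z \<rightarrow> {1..r}. \<exists>e \<in> embeddings Y Z.
        \<forall>f \<in> embeddings X Y. \<forall>g \<in> embeddings X Y.
          \<chi> (compose (univ X) e f) = \<chi> (compose (univ X) e g))"

definition ramsey :: "('r, 'a) struct \<Rightarrow> bool" where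
  "ramsey A \<longleftrightarrow> (\<forall>X \<in> age A. \<forall>Y \<in> age A. \<forall>r. \<exists>Z \<in> age A. ramsey_arrow Z Y X r)"

section \<open>First-order formulas, types and reducts\<close>

datatype 'r fo =
    Equal nat nat
  | Rel 'r "nat list"
  | Neg "'r fo"
  | Conj "'r fo" "'r fo"
  | Ex nat "'r fo"

fun wf_fo :: "('r \<rightharpoonup> nat) \<Rightarrow> 'r fo \<Rightarrow> bool" where
  "wf_fo \<tau> (Equal i j) = True"
| "wf_fo \<tau> (Rel r vs) = (\<tau> r = Some (length vs))"
| "wf_fo \<tau> (Neg \<phi>) = wf_fo \<tau> \<phi>"
| "wf_fo \<tau> (Conj \<phi> \<psi>) = (wf_fo \<tau> \<phi> \<and> wf_fo \<tau> \<psi>)"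
| "wf_fo \<tau> (Ex i \<phi>) = wf_fo \<tau> \<phi>"

fun free_vars :: "'r fo \<Rightarrow> nat set" where
  "free_vars (Equal i j) = {i, j}"
| "free_vars (Rel r vs) = set vs"
| "free_vars (Neg \<phi>) = free_vars \<phi>"
| "free_vars (Conj \<phi> \<psi>) = free_vars \<phi> \<union> free_vars \<psi>"
| "free_vars (Ex i \<phi>) = free_vars \<phi> - {i}"

fun sat :: "('r, 'a) struct \<Rightarrow> (nat \<Rightarrow> 'a) \<Rightarrow> 'r fo \<Rightarrow> bool" where
  "sat A s (Equal i j) = (s i = s j)"
| "sat A s (Rel r vs) = (map s vs \<in> rel A r)"
| "sat A s (Neg \<phi>) = (\<not> sat A s \<phi>)"
| "sat A s (Conj \<phi> \<psi>) = (sat A s \<phi> \<and> sat A s \<psi>)"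
| "sat A s (Ex i \<phi>) = (\<exists>a \<in> univ A. sat A (s(i := a)) \<phi>)"

definition formulas :: "('r \<rightharpoonup> nat) \<Rightarrow> nat \<Rightarrow> 'r fo set" where
  "formulas \<tau> n = {\<phi>. wf_fo \<tau> \<phi> \<and> free_vars \<phi> \<subseteq> {..<n}}"

definition fo_type :: "('r, 'a) struct \<Rightarrow> 'a list \<Rightarrow> 'r fo set" where
  "fo_type A a = {\<phi> \<in> formulas (signat A) (length a). sat A (\<lambda>i. a ! i) \<phi>}"

text \<open>
  Reducts are first-order reducts: the relations of the reduct need only be first-order definable
  without parameters.  Structures obtained by forgetting relations are a special case.
\<close>

definition reduct :: "('s, 'a) struct \<Rightarrow> ('r, 'a) struct \<Rightarrow> bool" where
  "reduct C A \<longleftrightarrow> univ C = univ A \<and>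
     (\<forall>r n. signat C r = Some n \<longrightarrow>
       (\<exists>\<phi> \<in> formulas (signat A) n.
          \<forall>xs \<in> tuples n (univ A). xs \<in> rel C r \<longleftrightarrow> sat A (\<lambda>i. xs ! i) \<phi>))"

section \<open>Operations and clones\<close>

text \<open>
  An operation on (the whole type) \<open>'a\<close> is a pair of its arity \<open>k\<close> and a function that is extensional
  on the lists of length \<open>k\<close>, so that equality of pairs is equality of operations.  Arguments are
  numbered from 0.  Clones contain operations of arity at least 1 only.
\<close>

type_synonym 'a operation = "nat \<times> ('a list \<Rightarrow> 'a)"

abbreviation arity :: "'a operation \<Rightarrow> nat" where "arity f \<equiv> fst f"

abbreviation app :: "'a operation \<Rightarrow> 'a list \<Rightarrow> 'a" where "app f \<equiv> snd f"

definition mk_op :: "nat \<Rightarrow> ('a list \<Rightarrow> 'a) \<Rightarrow> 'a operation" where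
  "mk_op k F = (k, restrict F (tuples k UNIV))"

definition power_struct :: "('r, 'a) struct \<Rightarrow> nat \<Rightarrow> ('r, 'a list) struct" where
  "power_struct C k = \<lparr>signat = signat C, univ = tuples k (univ C),
     rel = (\<lambda>r. {ts. \<forall>i<k. map (\<lambda>t. t ! i) ts \<in> rel C r})\<rparr>"

definition Pol :: "('r, 'a) struct \<Rightarrow> 'a operation set" where
  "Pol C = {f. arity f \<ge> 1 \<and> app f \<in> homs (power_struct C (arity f)) C}"

definition Proj :: "bool operation set" where
  "Proj = {mk_op k (\<lambda>xs. xs ! i) | k i. i < k}"

definition minor :: "'a operation \<Rightarrow> nat \<Rightarrow> (nat \<Rightarrow> nat) \<Rightarrow> 'a operation" where
  "minor f k \<alpha> = mk_op k (\<lambda>xs. app f (map (\<lambda>i. xs ! \<alpha> i) [0..<arity f]))"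

definition minor_preserving ::
  "'a operation set \<Rightarrow> ('a operation \<Rightarrow> 'b operation) \<Rightarrow> bool" where
  "minor_preserving \<C> \<zeta> \<longleftrightarrow>
     (\<forall>f \<in> \<C>. arity (\<zeta> f) = arity f \<and>
        (\<forall>k. \<forall>\<alpha> \<in> {..<arity f} \<rightarrow> {..<k}. \<zeta> (minor f k \<alpha>) = minor (\<zeta> f) k \<alpha>))"

text \<open>\<open>inner f [v\<^sub>1, \<dots>, v\<^sub>k]\<close> is $f(v_1,\dots,v_k)$ and \<open>outer u f\<close> is $u(f)$.\<close>

definition inner :: "'a operation \<Rightarrow> ('a \<Rightarrow> 'a) list \<Rightarrow> 'a operation" where
  "inner f vs = mk_op (arity f) (\<lambda>xs. app f (map2 (\<lambda>v x. v x) vs xs))"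

definition outer :: "('a \<Rightarrow> 'a) \<Rightarrow> 'a operation \<Rightarrow> 'a operation" where
  "outer u f = mk_op (arity f) (\<lambda>xs. u (app f xs))"

definition invariant_under ::
  "('a \<Rightarrow> 'a) set \<Rightarrow> 'a operation set \<Rightarrow> ('a operation \<Rightarrow> 'b) \<Rightarrow> bool" where
  "invariant_under M \<C> \<zeta> \<longleftrightarrow>
     (\<forall>f \<in> \<C>. \<forall>u \<in> M. \<forall>vs \<in> tuples (arity f) M. \<zeta> f = \<zeta> (outer u (inner f vs)))"

definition Aut_closure :: "('r, 'a) struct \<Rightarrow> ('a \<Rightarrow> 'a) set" where
  "Aut_closure A = {u \<in> univ A \<rightarrow>\<^sub>E univ A.
     \<forall>F. finite F \<and> F \<subseteq> univ A \<longrightarrow> (\<exists>\<alpha> \<in> Aut A. \<forall>x \<in> F. u x = \<alpha> x)}"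

text \<open>
  \<open>componentwise f n as\<close> applies \<open>f\<close> to a list \<open>as\<close> of \<open>n\<close>-tuples, one for each argument of \<open>f\<close>.
\<close>

definition componentwise :: "'a operation \<Rightarrow> nat \<Rightarrow> 'a list list \<Rightarrow> 'a list" where
  "componentwise f n as = map (\<lambda>j. app f (map (\<lambda>a. a ! j) as)) [0..<n]"

definition canonical :: "('r, 'a) struct \<Rightarrow> 'a operation \<Rightarrow> bool" where
  "canonical A f \<longleftrightarrow>
     (\<forall>n. \<forall>as \<in> tuples (arity f) (tuples n (univ A)). \<forall>bs \<in> tuples (arity f) (tuples n (univ A)).
        (\<forall>i < arity f. fo_type A (as ! i) = fo_type A (bs ! i)) \<longrightarrow>
        fo_type A (componentwise f n as) = fo_type A (componentwise f n bs))"

definition canonical_Pol :: "('r, 'a) struct \<Rightarrow> ('s, 'a) struct \<Rightarrow> 'a operation set" where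
  "canonical_Pol A C = {f \<in> Pol C. canonical A f}"

definition interpolates ::
  "('a \<Rightarrow> 'a) set \<Rightarrow> 'a operation \<Rightarrow> 'a operation \<Rightarrow> bool" where
  "interpolates M f g \<longleftrightarrow> arity f = arity g \<and>
     (\<forall>F. finite F \<longrightarrow> (\<exists>u \<in> M. \<exists>vs \<in> tuples (arity f) M.
        \<forall>xs \<in> tuples (arity f) F. app g xs = u (app f (map2 (\<lambda>v x. v x) vs xs))))"

definition UIP ::
  "('r, 'a) struct \<Rightarrow> 'a operation set \<Rightarrow> 'a operation set \<Rightarrow> ('a operation \<Rightarrow> 'b) \<Rightarrow> bool" where
  "UIP A P D \<zeta> \<longleftrightarrow>
     (\<forall>g \<in> D. \<forall>h \<in> D. \<forall>f \<in> P.
        interpolates (Aut A) f g \<and> interpolates (Aut A) f h \<longrightarrow> \<zeta> g = \<zeta> h)"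

end

theory Submission
  imports Defs
begin

text \<open>
  If \<open>u\<close> is a limit of automorphisms, then \<open>f\<close> interpolates \<open>f(id, u)\<close>, so the UIP implies the
  binary condition at once.  The work is in the converse.

  Suppose that \<open>f\<close> interpolates two canonical operations \<open>g\<close> and \<open>h\<close>.  Since \<open>\<zeta> g\<close> and \<open>\<zeta> h\<close> are
  projections, they agree as soon as all of their minors agree that arise from a partition of the
  arguments into two blocks; fix such a partition.  On a finite set \<open>Z\<close> the operations \<open>g\<close> and \<open>h\<close> look,
  up to an automorphism applied to the values, like \<open>f(\<alpha>\<^sub>1, \<dots>, \<alpha>\<^sub>k)\<close> and \<open>f(\<beta>\<^sub>1, \<dots>, \<beta>\<^sub>k)\<close> with automorphisms
  \<open>\<alpha>\<^sub>i\<close> and \<open>\<beta>\<^sub>i\<close>.  The idea is to connect \<open>g\<close> with \<open>h\<close> through a place where the two representations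
  coincide.  By the Ramsey property there is an automorphism \<open>\<gamma>\<close> such that all the images \<open>\<alpha>\<^sub>i(Z)\<close> and
  \<open>\<beta>\<^sub>i(Z)\<close> have the same type over \<open>\<gamma>(Z)\<close> as \<open>Z\<close> itself (lemma \<open>independent_copy\<close>; this is a finite
  trace of a global type that is invariant under all automorphisms).  Hence \<open>\<alpha>\<^sub>i\<close> and \<open>\<beta>\<^sub>i\<close> can be changed
  outside of \<open>Z\<close> so as to fix \<open>\<gamma>(Z)\<close> pointwise.  After this change the operations \<open>p = f(\<alpha>\<^sub>1, \<dots>, \<alpha>\<^sub>k)\<close> and
  \<open>q = f(\<beta>\<^sub>1, \<dots>, \<beta>\<^sub>k)\<close> still represent \<open>g\<close> and \<open>h\<close> on \<open>Z\<close>, but \<open>p(\<gamma>, \<dots>, \<gamma>)\<close> and \<open>q(\<gamma>, \<dots>, \<gamma>)\<close> agree on \<open>Z\<close>.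

  Now read \<open>p\<close> and \<open>q\<close> as binary operations, one argument for each block.  Moving first the second
  argument and then the first argument from \<open>id\<close> to \<open>\<gamma>\<close> leads from \<open>p(id, id)\<close> to \<open>p(\<gamma>, \<gamma>)\<close>, and each move
  changes one argument only, as in the binary condition.  Another application of the Ramsey property,
  now independently in the two arguments, makes the operations that are passed on the way canonical
  on a given finite set (lemma \<open>canonisation\<close>).  A compactness argument replaces the finite
  approximations by global polymorphisms and by limits of automorphisms (lemma \<open>linked_limit\<close>).  The
  binary condition then says that \<open>\<zeta>\<close> is constant along both paths; the paths meet in their
  last point, and their first points behave locally like the minors of \<open>g\<close> and \<open>h\<close>.  Two canonical
  operations with the same local behaviour become equal after composition with limits of
  automorphisms, so they have the same value under \<open>\<zeta>\<close> (lemma \<open>invariant_similar\<close>).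
\<close>

section \<open>Automorphisms and atomic types\<close>

locale finitely_homogeneous_structure =
  fixes A :: "('r, 'a::countable) struct"
  assumes univ_A [simp]: "univ A = UNIV"
    and homogeneous_A: "homogeneous A"
    and finite_signature: "finite (dom (signat A))"
begin

lemma Aut_iff:
  "\<alpha> \<in> Aut A \<longleftrightarrow> bij \<alpha> \<and>
     (\<forall>r xs. signat A r = Some (length xs) \<longrightarrow> (map \<alpha> xs \<in> rel A r \<longleftrightarrow> xs \<in> rel A r))"
  by (auto simp: Aut_def isos_def embeddings_def tuples_def bij_def)

lemma Aut_rel:
  "\<alpha> \<in> Aut A \<Longrightarrow> signat A r = Some (length xs) \<Longrightarrow> map \<alpha> xs \<in> rel A r \<longleftrightarrow> xs \<in> rel A r"
  by (simp add: Aut_iff)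

lemma Aut_id [simp]: "id \<in> Aut A"
  by (simp add: Aut_iff)

lemma Aut_comp [intro]:
  assumes "\<alpha> \<in> Aut A" and "\<beta> \<in> Aut A"
  shows "\<alpha> \<circ> \<beta> \<in> Aut A"
  unfolding Aut_iff
proof (intro conjI allI impI)
  show "bij (\<alpha> \<circ> \<beta>)" using assms by (simp add: Aut_iff bij_comp)
  fix r and xs :: "'a list" assume r: "signat A r = Some (length xs)"
  then have "map \<alpha> (map \<beta> xs) \<in> rel A r \<longleftrightarrow> map \<beta> xs \<in> rel A r"
    using assms(1) by (simp only: Aut_rel length_map)
  also have "\<dots> \<longleftrightarrow> xs \<in> rel A r"
    using assms(2) r by (simp add: Aut_iff)
  finally show "map (\<alpha> \<circ> \<beta>) xs \<in> rel A r \<longleftrightarrow> xs \<in> rel A r" by simp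
qed

lemma Aut_inv [intro]:
  assumes "\<alpha> \<in> Aut A"
  shows "inv \<alpha> \<in> Aut A"
  unfolding Aut_iff
proof (intro conjI allI impI)
  have bij: "bij \<alpha>" using assms by (simp add: Aut_iff)
  then show "bij (inv \<alpha>)" by (rule bij_imp_bij_inv)
  fix r and xs :: "'a list" assume "signat A r = Some (length xs)"
  moreover have "map \<alpha> (map (inv \<alpha>) xs) = xs"
    using bij by (auto intro!: map_idI simp: bij_is_surj surj_f_inv_f)
  ultimately show "map (inv \<alpha>) xs \<in> rel A r \<longleftrightarrow> xs \<in> rel A r"
    using Aut_rel[OF assms, of r "map (inv \<alpha>) xs"] by (simp del: map_map)
qed

lemma Aut_inv_apply [simp]:
  assumes "\<alpha> \<in> Aut A"
  shows "\<alpha> (inv \<alpha> x) = x" and "inv \<alpha> (\<alpha> x) = x"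
  using assms by (auto simp: Aut_iff bij_is_surj bij_is_inj surj_f_inv_f)

lemma Aut_inj: "\<alpha> \<in> Aut A \<Longrightarrow> \<alpha> x = \<alpha> y \<longleftrightarrow> x = y"
  by (metis Aut_inv_apply(2))

text \<open>
  The quantifier-free type of the tuple \<open>\<phi>\<close> that is indexed by \<open>S\<close>.  Arbitrary index sets make it
  possible to treat elements, values of operations and several tuples at once in the same way.
\<close>

definition atomic_type :: "'i set \<Rightarrow> ('i \<Rightarrow> 'a) \<Rightarrow> ('i \<times> 'i) set \<times> ('r \<times> 'i list) set" where
  "atomic_type S \<phi> =
     ({(s, t). s \<in> S \<and> t \<in> S \<and> \<phi> s = \<phi> t},
      {(r, xs). signat A r = Some (length xs) \<and> set xs \<subseteq> S \<and> map \<phi> xs \<in> rel A r})"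

text \<open>
  This is where the finite signature enters: atomic types can serve as the colours of Ramsey arguments.
\<close>

lemma finite_atomic_types:
  assumes "finite S"
  shows "finite {atomic_type T \<phi> | T \<phi>. T \<subseteq> S}"
proof (rule finite_subset)
  let ?R = "\<Union>r \<in> dom (signat A). {r} \<times> {xs. set xs \<subseteq> S \<and> length xs = the (signat A r)}"
  show "{atomic_type T \<phi> | T \<phi>. T \<subseteq> S} \<subseteq> Pow (S \<times> S) \<times> Pow ?R"
    unfolding atomic_type_def by fastforce
  show "finite (Pow (S \<times> S) \<times> Pow ?R)"
    using assms finite_signature
    by (auto intro!: finite_cartesian_product finite_lists_length_eq)
qed

text \<open>
  Homogeneity for indexed tuples: equality of types makes \<open>\<phi> s \<mapsto> \<psi> s\<close> a well-defined isomorphism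
  between finite substructures.
\<close>

lemma atomic_type_eqD:
  fixes S :: "'i set"
  assumes "finite S" and eq: "atomic_type S \<phi> = atomic_type S \<psi>"
  shows "\<exists>\<tau> \<in> Aut A. \<forall>s \<in> S. \<psi> s = \<tau> (\<phi> s)"
proof -
  have E: "\<phi> s = \<phi> t \<longleftrightarrow> \<psi> s = \<psi> t" if "s \<in> S" "t \<in> S" for s t
    using eq that unfolding atomic_type_def by blast
  have R: "map \<phi> xs \<in> rel A r \<longleftrightarrow> map \<psi> xs \<in> rel A r"
    if "signat A r = Some (length xs)" "set xs \<subseteq> S" for r xs
    using eq that unfolding atomic_type_def by blast
  define j where "j = inv_into S \<phi>"
  have j: "j (\<phi> s) \<in> S" "\<phi> (j (\<phi> s)) = \<phi> s" if "s \<in> S" for s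
    using that by (auto simp: j_def inv_into_into f_inv_into_f)
  define f where "f = restrict (\<lambda>x. \<psi> (j x)) (\<phi> ` S)"
  have f: "f (\<phi> s) = \<psi> s" if "s \<in> S" for s
    using that j[OF that] E by (auto simp: f_def)
  have "f \<in> isos (substructure A (\<phi> ` S)) (substructure A (\<psi> ` S))"
    unfolding isos_def embeddings_def
  proof (intro CollectI conjI allI impI ballI)
    show "inj_on f (univ (substructure A (\<phi> ` S)))"
      using E f by (auto simp: inj_on_def substructure_def)
    fix r n xs
    assume r: "signat (substructure A (\<phi> ` S)) r = Some n"
      and xs: "xs \<in> tuples n (univ (substructure A (\<phi> ` S)))"
    let ?ys = "map j xs"
    have sub: "set xs \<subseteq> \<phi> ` S" and len: "length xs = n"
      using xs by (auto simp: tuples_def substructure_def)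
    have ys: "set ?ys \<subseteq> S" using sub j(1) by auto
    have "map \<phi> ?ys = xs"
      using sub j(2) by (auto intro!: map_idI)
    moreover have "map \<psi> ?ys = map f xs"
      using sub by (auto simp: f_def)
    moreover have "map \<phi> ?ys \<in> rel A r \<longleftrightarrow> map \<psi> ?ys \<in> rel A r"
      using r len ys by (intro R) (auto simp: substructure_def)
    ultimately have "xs \<in> rel A r \<longleftrightarrow> map f xs \<in> rel A r" by (simp only:)
    then show "xs \<in> rel (substructure A (\<phi> ` S)) r \<longleftrightarrow> map f xs \<in> rel (substructure A (\<psi> ` S)) r"
      by (simp_all add: substructure_def)
  next
    show "f \<in> univ (substructure A (\<phi> ` S)) \<rightarrow>\<^sub>E univ (substructure A (\<psi> ` S))"
      using f by (auto simp: substructure_def) (simp add: f_def)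
  next
    have "f ` (\<phi> ` S) = \<psi> ` S" unfolding image_image using f by (rule image_cong[OF refl])
    then show "f ` univ (substructure A (\<phi> ` S)) = univ (substructure A (\<psi> ` S))"
      by (simp add: substructure_def)
  qed (simp add: substructure_def)
  then obtain \<tau> where "\<tau> \<in> Aut A" "\<forall>x \<in> \<phi> ` S. \<tau> x = f x"
    using homogeneous_A \<open>finite S\<close> unfolding homogeneous_def
    by (metis finite_imageI subset_UNIV univ_A)
  moreover from this f have "\<forall>s \<in> S. \<psi> s = \<tau> (\<phi> s)" by simp
  ultimately show ?thesis by blast
qed

lemma atomic_type_eqI:
  assumes "\<And>s t. s \<in> S \<Longrightarrow> t \<in> S \<Longrightarrow> \<phi> s = \<phi> t \<longleftrightarrow> \<psi> s = \<psi> t"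
    and "\<And>r xs. signat A r = Some (length xs) \<Longrightarrow> set xs \<subseteq> S \<Longrightarrow>
      map \<phi> xs \<in> rel A r \<longleftrightarrow> map \<psi> xs \<in> rel A r"
  shows "atomic_type S \<phi> = atomic_type S \<psi>"
  using assms unfolding atomic_type_def by (auto simp del: map_eq_conv)

lemma atomic_type_cong:
  assumes "\<And>s. s \<in> S \<Longrightarrow> \<phi> s = \<psi> s"
  shows "atomic_type S \<phi> = atomic_type S \<psi>"
proof -
  have "map \<phi> xs = map \<psi> xs" if "set xs \<subseteq> S" for xs
    using assms that by (intro map_cong) auto
  then show ?thesis unfolding atomic_type_def using assms by (auto simp del: map_eq_conv)
qed

section \<open>First-order types are orbits\<close>

lemma sat_cong:
  "(\<And>i. i \<in> free_vars \<phi> \<Longrightarrow> s i = t i) \<Longrightarrow> sat A s \<phi> \<longleftrightarrow> sat A t \<phi>"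
proof (induction \<phi> arbitrary: s t)
  case (Rel r vs)
  then have "map s vs = map t vs" by simp
  then show ?case by (simp del: map_eq_conv)
next
  case (Neg \<phi>)
  have "sat A s \<phi> \<longleftrightarrow> sat A t \<phi>" by (rule Neg.IH) (simp add: Neg.prems)
  then show ?case by simp
next
  case (Conj \<phi> \<psi>)
  have "sat A s \<phi> \<longleftrightarrow> sat A t \<phi>" by (rule Conj.IH(1)) (simp add: Conj.prems)
  moreover have "sat A s \<psi> \<longleftrightarrow> sat A t \<psi>" by (rule Conj.IH(2)) (simp add: Conj.prems)
  ultimately show ?case by simp
next
  case (Ex i \<phi>)
  have "sat A (s(i := a)) \<phi> \<longleftrightarrow> sat A (t(i := a)) \<phi>" for a
    by (rule Ex.IH) (simp add: Ex.prems)
  then show ?case by simp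
qed simp

lemma sat_Aut:
  assumes "\<tau> \<in> Aut A" and "wf_fo (signat A) \<phi>"
  shows "sat A (\<tau> \<circ> s) \<phi> \<longleftrightarrow> sat A s \<phi>"
  using assms(2)
proof (induction \<phi> arbitrary: s)
  case (Equal i j)
  then show ?case using assms(1) by (simp add: Aut_inj)
next
  case (Rel r vs)
  then show ?case using Aut_rel[OF assms(1), of r "map s vs"] by (simp add: comp_def)
next
  case (Ex i \<phi>)
  have "(\<tau> \<circ> s)(i := \<tau> a) = \<tau> \<circ> s(i := a)" for a by auto
  then have shift: "sat A ((\<tau> \<circ> s)(i := \<tau> a)) \<phi> \<longleftrightarrow> sat A (s(i := a)) \<phi>" for a
    using Ex by (simp only: wf_fo.simps)
  have "(\<exists>b. P b) \<longleftrightarrow> (\<exists>a. P (\<tau> a))" for P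
    by (rule iffI, (erule exE, rule exI[of _ "inv \<tau> b" for b], simp add: assms(1)), blast)
  from this[of "\<lambda>b. sat A ((\<tau> \<circ> s)(i := b)) \<phi>"]
  show ?case unfolding sat.simps univ_A bex_UNIV shift .
qed auto

lemma sat_list_Aut:
  assumes "\<tau> \<in> Aut A" and "\<phi> \<in> formulas (signat A) (length xs)"
  shows "sat A (\<lambda>i. map \<tau> xs ! i) \<phi> \<longleftrightarrow> sat A (\<lambda>i. xs ! i) \<phi>"
proof -
  have "sat A (\<lambda>i. map \<tau> xs ! i) \<phi> \<longleftrightarrow> sat A (\<tau> \<circ> (\<lambda>i. xs ! i)) \<phi>"
    using assms(2) by (intro sat_cong) (auto simp: formulas_def)
  also have "\<dots> \<longleftrightarrow> sat A (\<lambda>i. xs ! i) \<phi>"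
    using assms by (intro sat_Aut) (auto simp: formulas_def)
  finally show ?thesis .
qed

text \<open>
  A first-order type determines in particular the atomic type, hence the orbit, by homogeneity.
\<close>

lemma fo_type_eq_iff:
  assumes "length a = length b"
  shows "fo_type A a = fo_type A b \<longleftrightarrow> (\<exists>\<tau> \<in> Aut A. b = map \<tau> a)"
proof
  assume eq: "fo_type A a = fo_type A b"
  let ?S = "{..<length a}"
  have sat: "sat A (\<lambda>i. a ! i) \<phi> \<longleftrightarrow> sat A (\<lambda>i. b ! i) \<phi>"
    if "\<phi> \<in> formulas (signat A) (length a)" for \<phi>
  proof -
    have "\<phi> \<in> fo_type A a \<longleftrightarrow> \<phi> \<in> fo_type A b" unfolding eq ..
    then show ?thesis using that assms unfolding fo_type_def mem_Collect_eq by metis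
  qed
  have "a ! s = a ! t \<longleftrightarrow> b ! s = b ! t" if "s \<in> ?S" "t \<in> ?S" for s t
    using sat[of "Equal s t"] that by (simp add: formulas_def)
  moreover have "map (\<lambda>i. a ! i) vs \<in> rel A r \<longleftrightarrow> map (\<lambda>i. b ! i) vs \<in> rel A r"
    if "signat A r = Some (length vs)" "set vs \<subseteq> ?S" for r vs
    using sat[of "Rel r vs"] that by (simp add: formulas_def)
  ultimately have "atomic_type ?S (\<lambda>i. a ! i) = atomic_type ?S (\<lambda>i. b ! i)"
    by (intro atomic_type_eqI)
  from atomic_type_eqD[OF finite_lessThan this]
  obtain \<tau> where "\<tau> \<in> Aut A" "\<forall>i \<in> ?S. b ! i = \<tau> (a ! i)" by blast
  then show "\<exists>\<tau> \<in> Aut A. b = map \<tau> a"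
    using assms by (intro bexI[of _ \<tau>] nth_equalityI) auto
next
  assume "\<exists>\<tau> \<in> Aut A. b = map \<tau> a"
  then obtain \<tau> where "\<tau> \<in> Aut A" "b = map \<tau> a" by auto
  then show "fo_type A a = fo_type A b"
    by (auto simp: fo_type_def sat_list_Aut)
qed

section \<open>Compactness up to automorphisms\<close>

lemma finite_initial_segment: "finite (to_nat -` {..<n} :: 'x::countable set)"
  by (intro finite_vimageI) auto

lemma finite_subset_initial_segment:
  fixes F :: "'x::countable set"
  assumes "finite F"
  shows "\<exists>n. F \<subseteq> to_nat -` {..<n}"
  using finite_nat_set_iff_bounded[of "to_nat ` F"] assms by auto

text \<open>
  A function \<open>\<psi>\<close> is built as a limit of approximations \<open>\<phi>\<close> for larger and larger finite sets \<open>X\<close>, where each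
  approximation may be moved by an automorphism.  Since a finite set \<open>E\<close> of indices admits only finitely
  many atomic types, infinitely many approximations look the same on \<open>E\<close>, and the limit exists by
  Koenig's lemma.
\<close>

lemma compactness:
  fixes R :: "'a set \<Rightarrow> ('i::countable \<Rightarrow> 'a) \<Rightarrow> bool"
  assumes ex: "\<And>X. finite X \<Longrightarrow> \<exists>\<phi>. R X \<phi>"
    and antimono: "\<And>X Y \<phi>. R Y \<phi> \<Longrightarrow> X \<subseteq> Y \<Longrightarrow> R X \<phi>"
  shows "\<exists>\<psi>. \<forall>X E. finite X \<longrightarrow> finite E \<longrightarrow>
    (\<exists>\<phi>. R X \<phi> \<and> (\<exists>\<tau> \<in> Aut A. \<forall>s \<in> E. \<psi> s = \<tau> (\<phi> s)))"
proof -
  define B :: "nat \<Rightarrow> 'a set" where "B n = to_nat -` {..<n}" for n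
  define D :: "nat \<Rightarrow> 'i set" where "D n = to_nat -` {..<n}" for n
  have "finite (B n)" for n unfolding B_def by (rule finite_initial_segment)
  then have "\<forall>n. \<exists>\<phi>. R (B n) \<phi>" by (intro allI ex)
  then obtain \<phi> where "\<forall>n. R (B n) (\<phi> n)" by (rule choice[THEN exE])
  then have \<phi>: "R (B n) (\<phi> n)" for n by blast
  \<comment> \<open>the stages whose approximation agrees with \<open>\<psi>\<close> on the first \<open>m\<close> indices, up to an automorphism\<close>
  define N where "N m \<psi> = {n. \<exists>\<tau> \<in> Aut A. \<forall>s \<in> D m. \<psi> s = \<tau> (\<phi> n s)}" for m \<psi>
  have "\<exists>\<psi>. \<forall>m. infinite (N m (\<psi> m)) \<and> (\<forall>s \<in> D m. \<psi> (Suc m) s = \<psi> m s)"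
  proof (rule dependent_nat_choice)
    show "\<exists>\<psi>. infinite (N 0 \<psi>)"
    proof
      have "n \<in> N 0 undefined" for n
        unfolding N_def D_def by (intro CollectI bexI[OF _ Aut_id]) simp
      then have "N 0 undefined = UNIV" by blast
      then show "infinite (N 0 undefined)" by simp
    qed
  next
    fix \<psi> m assume inf: "infinite (N m \<psi>)"
    let ?t = "\<lambda>n. atomic_type (D (Suc m)) (\<phi> n)"
    have finD: "finite (D (Suc m))" using finite_initial_segment by (simp add: D_def)
    have "finite (?t ` N m \<psi>)"
      by (rule finite_subset[OF _ finite_atomic_types[OF finD]]) blast
    from pigeonhole_infinite[OF inf this]
    obtain n0 where n0: "n0 \<in> N m \<psi>" and inf': "infinite {n \<in> N m \<psi>. ?t n = ?t n0}" by blast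
    from n0 obtain \<tau> where \<tau>: "\<tau> \<in> Aut A" "\<forall>s \<in> D m. \<psi> s = \<tau> (\<phi> n0 s)"
      by (auto simp: N_def)
    \<comment> \<open>move the approximation \<open>n0\<close> onto \<open>\<psi>\<close>; the others of the same type follow\<close>
    have "{n \<in> N m \<psi>. ?t n = ?t n0} \<subseteq> N (Suc m) (\<tau> \<circ> \<phi> n0)"
    proof
      fix n assume "n \<in> {n \<in> N m \<psi>. ?t n = ?t n0}"
      then have "?t n = ?t n0" by simp
      from atomic_type_eqD[OF finD this]
      obtain \<tau>' where "\<tau>' \<in> Aut A" "\<forall>s \<in> D (Suc m). \<phi> n0 s = \<tau>' (\<phi> n s)" by blast
      with \<tau>(1) show "n \<in> N (Suc m) (\<tau> \<circ> \<phi> n0)"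
        by (auto simp: N_def intro!: bexI[of _ "\<tau> \<circ> \<tau>'"])
    qed
    with inf' \<tau>(2) show "\<exists>\<psi>'. infinite (N (Suc m) \<psi>') \<and> (\<forall>s \<in> D m. \<psi>' s = \<psi> s)"
      by (intro exI[of _ "\<tau> \<circ> \<phi> n0"]) (auto dest: infinite_super)
  qed
  then obtain \<psi> where inf: "\<And>m. infinite (N m (\<psi> m))"
    and step: "\<And>m s. s \<in> D m \<Longrightarrow> \<psi> (Suc m) s = \<psi> m s" by blast
  define \<theta> where "\<theta> s = \<psi> (Suc (to_nat s)) s" for s
  have \<theta>: "\<theta> s = \<psi> m s" if "s \<in> D m" for s m
  proof -
    have "Suc (to_nat s) \<le> m" using that by (simp add: D_def)
    then show ?thesis
      by (induction m rule: dec_induct) (auto simp: \<theta>_def D_def step)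
  qed
  show ?thesis
  proof (rule exI[of _ \<theta>], intro allI impI)
    fix X :: "'a set" and E :: "'i set" assume "finite X" "finite E"
    then obtain n m where n: "X \<subseteq> B n" and m: "E \<subseteq> D m"
      using finite_subset_initial_segment unfolding B_def D_def by meson
    obtain k where k: "k \<ge> n" "k \<in> N m (\<psi> m)"
      using inf[of m] unfolding finite_nat_set_iff_bounded by (meson not_less)
    have "B n \<subseteq> B k" using k(1) by (auto simp: B_def)
    then have "R X (\<phi> k)" using \<phi> antimono n by blast
    moreover have "\<exists>\<tau> \<in> Aut A. \<forall>s \<in> E. \<theta> s = \<tau> (\<phi> k s)"
      using k(2) m \<theta> by (auto simp: N_def) (metis subsetD)
    ultimately show "\<exists>\<phi>. R X \<phi> \<and> (\<exists>\<tau> \<in> Aut A. \<forall>s \<in> E. \<theta> s = \<tau> (\<phi> s))" by blast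
  qed
qed

section \<open>Local canonicity of binary operations\<close>

text \<open>
  Canonicity restricted to arguments from \<open>X\<close>.  Tuples of the same type differ by an automorphism, so a
  pair of such tuples over \<open>X\<close> lives on the part of \<open>X\<close> that an automorphism keeps inside \<open>X\<close>.
\<close>

definition canonical_on :: "'a set \<Rightarrow> ('a \<Rightarrow> 'a \<Rightarrow> 'a) \<Rightarrow> bool" where
  "canonical_on X F \<longleftrightarrow> (\<forall>\<rho> \<in> Aut A. \<forall>\<rho>' \<in> Aut A. \<exists>\<tau> \<in> Aut A.
     \<forall>x \<in> X. \<forall>y \<in> X. \<rho> x \<in> X \<longrightarrow> \<rho>' y \<in> X \<longrightarrow> F (\<rho> x) (\<rho>' y) = \<tau> (F x y))"

definition similar_on :: "'a set \<Rightarrow> ('a \<Rightarrow> 'a \<Rightarrow> 'a) \<Rightarrow> ('a \<Rightarrow> 'a \<Rightarrow> 'a) \<Rightarrow> bool" where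
  "similar_on X F G \<longleftrightarrow> (\<exists>\<tau> \<in> Aut A. \<forall>x \<in> X. \<forall>y \<in> X. F x y = \<tau> (G x y))"

lemma similar_on_trans:
  assumes "similar_on X F G" and "similar_on X G H"
  shows "similar_on X F H"
proof -
  from assms(1) obtain \<sigma> where \<sigma>: "\<sigma> \<in> Aut A" "\<forall>x \<in> X. \<forall>y \<in> X. F x y = \<sigma> (G x y)"
    unfolding similar_on_def ..
  from assms(2) obtain \<tau> where \<tau>: "\<tau> \<in> Aut A" "\<forall>x \<in> X. \<forall>y \<in> X. G x y = \<tau> (H x y)"
    unfolding similar_on_def ..
  show ?thesis
    unfolding similar_on_def using \<sigma> \<tau> by (intro bexI[of _ "\<sigma> \<circ> \<tau>"]) auto
qed

lemma canonical_onD: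
  "canonical_on X F \<Longrightarrow> \<rho> \<in> Aut A \<Longrightarrow> \<rho>' \<in> Aut A \<Longrightarrow> \<exists>\<tau> \<in> Aut A.
     \<forall>x \<in> X. \<forall>y \<in> X. \<rho> x \<in> X \<longrightarrow> \<rho>' y \<in> X \<longrightarrow> F (\<rho> x) (\<rho>' y) = \<tau> (F x y)"
  unfolding canonical_on_def by (drule (1) bspec)+

lemma canonical_on_similar:
  assumes "similar_on X F G" and "canonical_on X G"
  shows "canonical_on X F"
  unfolding canonical_on_def
proof (intro ballI)
  fix \<rho> \<rho>' assume \<rho>: "\<rho> \<in> Aut A" "\<rho>' \<in> Aut A"
  from assms(1) obtain \<sigma> where \<sigma>: "\<sigma> \<in> Aut A" "\<forall>x \<in> X. \<forall>y \<in> X. F x y = \<sigma> (G x y)"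
    unfolding similar_on_def ..
  from canonical_onD[OF assms(2) \<rho>] obtain \<tau> where \<tau>: "\<tau> \<in> Aut A"
    "\<forall>x \<in> X. \<forall>y \<in> X. \<rho> x \<in> X \<longrightarrow> \<rho>' y \<in> X \<longrightarrow> G (\<rho> x) (\<rho>' y) = \<tau> (G x y)" ..
  show "\<exists>\<tau> \<in> Aut A. \<forall>x \<in> X. \<forall>y \<in> X. \<rho> x \<in> X \<longrightarrow> \<rho>' y \<in> X \<longrightarrow> F (\<rho> x) (\<rho>' y) = \<tau> (F x y)"
    using \<sigma> \<tau> by (intro bexI[of _ "\<sigma> \<circ> \<tau> \<circ> inv \<sigma>"]) auto
qed

lemma canonical_on_swap:
  assumes "canonical_on X F"
  shows "canonical_on X (\<lambda>x y. F y x)"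
  unfolding canonical_on_def
proof (intro ballI)
  fix \<rho> \<rho>' assume \<rho>: "\<rho> \<in> Aut A" "\<rho>' \<in> Aut A"
  from canonical_onD[OF assms \<rho>(2,1)] obtain \<tau> where "\<tau> \<in> Aut A"
    "\<forall>x \<in> X. \<forall>y \<in> X. \<rho>' x \<in> X \<longrightarrow> \<rho> y \<in> X \<longrightarrow> F (\<rho>' x) (\<rho> y) = \<tau> (F x y)" ..
  then show "\<exists>\<tau> \<in> Aut A. \<forall>x \<in> X. \<forall>y \<in> X. \<rho> x \<in> X \<longrightarrow> \<rho>' y \<in> X \<longrightarrow> F (\<rho>' y) (\<rho> x) = \<tau> (F y x)"
    by (intro bexI[of _ \<tau>]) auto
qed

lemma canonical_on_subset:
  assumes "canonical_on Y F" and "X \<subseteq> Y"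
  shows "canonical_on X F"
  unfolding canonical_on_def
proof (intro ballI)
  fix \<rho> \<rho>' assume \<rho>: "\<rho> \<in> Aut A" "\<rho>' \<in> Aut A"
  from canonical_onD[OF assms(1) \<rho>] obtain \<tau> where "\<tau> \<in> Aut A"
    "\<forall>x \<in> Y. \<forall>y \<in> Y. \<rho> x \<in> Y \<longrightarrow> \<rho>' y \<in> Y \<longrightarrow> F (\<rho> x) (\<rho>' y) = \<tau> (F x y)" ..
  with assms(2)
  show "\<exists>\<tau> \<in> Aut A. \<forall>x \<in> X. \<forall>y \<in> X. \<rho> x \<in> X \<longrightarrow> \<rho>' y \<in> X \<longrightarrow> F (\<rho> x) (\<rho>' y) = \<tau> (F x y)"
    by (intro bexI[of _ \<tau>]) auto
qed

lemma similar_on_subset: "similar_on Y F G \<Longrightarrow> X \<subseteq> Y \<Longrightarrow> similar_on X F G"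
  unfolding similar_on_def by blast

end

section \<open>Ramsey theorems for colourings of automorphisms\<close>

lemma embeddings_compose:
  assumes f: "f \<in> embeddings X Y" and g: "g \<in> embeddings Y Z"
  shows "compose (univ X) g f \<in> embeddings X Z"
proof -
  have f_in: "f x \<in> univ Y" if "x \<in> univ X" for x
    using f that by (auto simp: embeddings_def)
  have "xs \<in> rel X r \<longleftrightarrow> map (compose (univ X) g f) xs \<in> rel Z r"
    if "signat X r = Some n" "xs \<in> tuples n (univ X)" for r n xs
  proof -
    have "xs \<in> rel X r \<longleftrightarrow> map f xs \<in> rel Y r"
      using f that by (auto simp: embeddings_def)
    also have "\<dots> \<longleftrightarrow> map g (map f xs) \<in> rel Z r"
    proof -
      have "map f xs \<in> tuples n (univ Y)" "signat Y r = Some n"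
        using f that f_in by (auto simp: embeddings_def tuples_def)
      then show ?thesis using g unfolding embeddings_def by blast
    qed
    also have "map g (map f xs) = map (compose (univ X) g f) xs"
      using that by (auto simp: tuples_def compose_def)
    finally show ?thesis .
  qed
  moreover have "compose (univ X) g f \<in> univ X \<rightarrow>\<^sub>E univ Z"
    using f g f_in by (auto simp: embeddings_def compose_def)
  moreover have "inj_on (compose (univ X) g f) (univ X)"
    using f g f_in by (auto simp: embeddings_def inj_on_def compose_def)
  ultimately show ?thesis
    using f g by (auto simp: embeddings_def)
qed

locale ramsey_structure = finitely_homogeneous_structure A
  for A :: "('r, 'a::countable) struct" +
  assumes ramsey_A: "ramsey A"
begin

text \<open>
  The age consists of structures on natural numbers; \<open>nat_copy S\<close> is the member of the age that
  represents the finite substructure with domain \<open>S\<close>.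
\<close>

definition nat_copy :: "'a set \<Rightarrow> ('r, nat) struct" where
  "nat_copy S = \<lparr>signat = signat A, univ = to_nat ` S, rel = (\<lambda>r. map to_nat ` rel A r)\<rparr>"

lemma map_to_nat_in_iff [simp]: "map to_nat xs \<in> map to_nat ` R \<longleftrightarrow> xs \<in> R" for R :: "'a list set"
  by (simp add: inj_image_mem_iff inj_mapI)

lemma tuples_image: "tuples n (f ` S) = map f ` tuples n S"
proof
  show "tuples n (f ` S) \<subseteq> map f ` tuples n S"
  proof
    fix xs assume "xs \<in> tuples n (f ` S)"
    then have "map (inv_into S f) xs \<in> tuples n S" "map f (map (inv_into S f) xs) = xs"
      by (auto simp: tuples_def inv_into_into f_inv_into_f subset_iff intro!: map_idI)
    then show "xs \<in> map f ` tuples n S" by (metis imageI)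
  qed
qed (auto simp: tuples_def subset_iff)

lemma embedding_nat_copy: "restrict from_nat (to_nat ` S) \<in> embeddings (nat_copy S) A"
proof -
  have "map (restrict from_nat (to_nat ` S)) (map to_nat ys) = ys" if "ys \<in> tuples n S" for ys n
    using that by (auto simp: tuples_def intro!: map_idI)
  then show ?thesis
    by (auto simp: embeddings_def nat_copy_def tuples_image inj_on_def simp del: map_map)
qed

lemma nat_copy_in_age: "finite S \<Longrightarrow> nat_copy S \<in> age A"
  using embedding_nat_copy[of S] by (auto simp: age_def nat_copy_def)

lemma Aut_embedding_nat_copy:
  assumes "\<rho> \<in> Aut A" and "\<rho> ` P \<subseteq> S"
  shows "restrict (\<lambda>n. to_nat (\<rho> (from_nat n))) (to_nat ` P) \<in> embeddings (nat_copy P) (nat_copy S)"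
    (is "?f \<in> _")
proof -
  have f: "map ?f (map to_nat ys) = map to_nat (map \<rho> ys)" if "ys \<in> tuples n P" for ys n
    using that by (auto simp: tuples_def)
  have "map to_nat ys \<in> map to_nat ` rel A r \<longleftrightarrow> map ?f (map to_nat ys) \<in> map to_nat ` rel A r"
    if "ys \<in> tuples n P" "signat A r = Some n" for ys n r
    unfolding f[OF that(1)] map_to_nat_in_iff
    using that Aut_rel[OF assms(1)] by (auto simp: tuples_def)
  moreover have "?f \<in> to_nat ` P \<rightarrow>\<^sub>E to_nat ` S" using assms(2) by auto
  moreover have "inj_on ?f (to_nat ` P)" using assms(1) by (auto simp: inj_on_def Aut_inj)
  ultimately show ?thesis
    by (simp add: embeddings_def nat_copy_def tuples_image del: map_map)
qed

lemma embedding_nat_copy_extends: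
  assumes e: "e \<in> embeddings (nat_copy S) A" and "finite S"
  shows "\<exists>\<rho> \<in> Aut A. \<forall>x \<in> S. e (to_nat x) = \<rho> x"
proof -
  have inj: "inj_on e (to_nat ` S)" using e by (simp add: embeddings_def nat_copy_def)
  have "xs \<in> rel A r \<longleftrightarrow> map (\<lambda>x. e (to_nat x)) xs \<in> rel A r"
    if "signat A r = Some (length xs)" "set xs \<subseteq> S" for r xs
  proof -
    have "map to_nat xs \<in> tuples (length xs) (univ (nat_copy S))"
      using that by (auto simp: tuples_def nat_copy_def)
    moreover have "signat (nat_copy S) r = Some (length xs)"
      using that by (simp add: nat_copy_def)
    ultimately have "map to_nat xs \<in> rel (nat_copy S) r \<longleftrightarrow> map e (map to_nat xs) \<in> rel A r"
      using e unfolding embeddings_def by blast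
    then show ?thesis by (simp add: nat_copy_def comp_def)
  qed
  then have "atomic_type S (\<lambda>x. x) = atomic_type S (\<lambda>x. e (to_nat x))"
    using inj by (intro atomic_type_eqI) (auto dest: inj_onD)
  from atomic_type_eqD[OF \<open>finite S\<close> this] show ?thesis .
qed

text \<open>
  By homogeneity, the copies of a finite set \<open>P\<close> are the restrictions of automorphisms to \<open>P\<close>.
  A colouring of these copies is therefore represented by a colouring of automorphisms which depends
  on the values on \<open>P\<close> only.
\<close>

definition determined_on :: "'a set \<Rightarrow> (('a \<Rightarrow> 'a) \<Rightarrow> 'k) \<Rightarrow> bool" where
  "determined_on P \<chi> \<longleftrightarrow>
     (\<forall>\<rho> \<in> Aut A. \<forall>\<rho>' \<in> Aut A. (\<forall>x \<in> P. \<rho> x = \<rho>' x) \<longrightarrow> \<chi> \<rho> = \<chi> \<rho>')"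

lemma determined_onD:
  "determined_on P \<chi> \<Longrightarrow> \<rho> \<in> Aut A \<Longrightarrow> \<rho>' \<in> Aut A \<Longrightarrow> (\<And>x. x \<in> P \<Longrightarrow> \<rho> x = \<rho>' x) \<Longrightarrow>
     \<chi> \<rho> = \<chi> \<rho>'"
  unfolding determined_on_def by blast

definition homogenises ::
  "('a \<Rightarrow> 'a) \<Rightarrow> 'a set \<Rightarrow> 'a set \<Rightarrow> (('a \<Rightarrow> 'a) \<Rightarrow> 'k) \<Rightarrow> bool" where
  "homogenises \<delta> P Y \<chi> \<longleftrightarrow>
     (\<forall>\<rho> \<in> Aut A. \<forall>\<rho>' \<in> Aut A. \<rho> ` P \<subseteq> Y \<and> \<rho>' ` P \<subseteq> Y \<longrightarrow> \<chi> (\<delta> \<circ> \<rho>) = \<chi> (\<delta> \<circ> \<rho>'))"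

lemma homogenisesD:
  "homogenises \<delta> P Y \<chi> \<Longrightarrow> \<rho> \<in> Aut A \<Longrightarrow> \<rho>' \<in> Aut A \<Longrightarrow> \<rho> ` P \<subseteq> Y \<Longrightarrow> \<rho>' ` P \<subseteq> Y \<Longrightarrow>
     \<chi> (\<delta> \<circ> \<rho>) = \<chi> (\<delta> \<circ> \<rho>')"
  unfolding homogenises_def by blast

text \<open>
  The Ramsey property, transferred from embeddings between members of the age to automorphisms.
\<close>

lemma ramsey_single:
  fixes K :: "'k set"
  assumes "finite P" and "finite Y" and "finite K"
  shows "\<exists>Z. finite Z \<and> (\<forall>\<chi>. determined_on P \<chi> \<and> range \<chi> \<subseteq> K \<longrightarrow>
    (\<exists>\<delta> \<in> Aut A. \<delta> ` Y \<subseteq> Z \<and> homogenises \<delta> P Y \<chi>))"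
proof -
  obtain Z where Z: "Z \<in> age A" and arrow: "ramsey_arrow Z (nat_copy Y) (nat_copy P) (card K)"
    using ramsey_A nat_copy_in_age assms unfolding ramsey_def by meson
  obtain z where z: "z \<in> embeddings Z A" using Z by (auto simp: age_def)
  show ?thesis
  proof (intro exI[of _ "z ` univ Z"] conjI allI impI)
    show "finite (z ` univ Z)" using Z by (simp add: age_def)
    fix \<chi> :: "('a \<Rightarrow> 'a) \<Rightarrow> 'k" assume \<chi>: "determined_on P \<chi> \<and> range \<chi> \<subseteq> K"
    obtain h where h: "bij_betw h K {1..card K}"
      using ex_bij_betw_finite_nat[OF \<open>finite K\<close>] ex_bij_betw_nat_finite_1[OF \<open>finite K\<close>]
        bij_betw_inv_into by blast
    \<comment> \<open>an embedding is coloured by the colour of an automorphism that extends it\<close>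
    have "\<forall>f \<in> embeddings (nat_copy P) Z. \<exists>\<rho>. \<rho> \<in> Aut A \<and> (\<forall>x \<in> P. z (f (to_nat x)) = \<rho> x)"
      using embedding_nat_copy_extends[OF embeddings_compose[OF _ z] \<open>finite P\<close>]
      by (simp add: compose_def nat_copy_def Bex_def)
    from bchoice[OF this] obtain ext
      where ext: "ext f \<in> Aut A" "\<forall>x \<in> P. z (f (to_nat x)) = ext f x"
      if "f \<in> embeddings (nat_copy P) Z" for f
      by blast
    have "(\<lambda>f. h (\<chi> (ext f))) \<in> embeddings (nat_copy P) Z \<rightarrow> {1..card K}"
      using \<chi> bij_betwE[OF h] by blast
    from bspec[OF arrow[unfolded ramsey_arrow_def] this] obtain e where e: "e \<in> embeddings (nat_copy Y) Z"
      and mono: "\<forall>f \<in> embeddings (nat_copy P) (nat_copy Y). \<forall>g \<in> embeddings (nat_copy P) (nat_copy Y).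
        h (\<chi> (ext (compose (univ (nat_copy P)) e f))) = h (\<chi> (ext (compose (univ (nat_copy P)) e g)))"
      by blast
    have "\<exists>\<delta> \<in> Aut A. \<forall>x \<in> Y. z (e (to_nat x)) = \<delta> x"
      using embedding_nat_copy_extends[OF embeddings_compose[OF e z] \<open>finite Y\<close>]
      by (simp add: compose_def nat_copy_def)
    then obtain \<delta> where \<delta>: "\<delta> \<in> Aut A" "\<And>x. x \<in> Y \<Longrightarrow> \<delta> x = z (e (to_nat x))" by auto
    have "e (to_nat x) \<in> univ Z" if "x \<in> Y" for x
      using e that by (auto simp: embeddings_def nat_copy_def)
    then have "\<delta> ` Y \<subseteq> z ` univ Z" using \<delta>(2) by auto
    moreover have "homogenises \<delta> P Y \<chi>"
      unfolding homogenises_def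
    proof (intro ballI impI)
      fix \<rho> \<rho>' assume \<rho>: "\<rho> \<in> Aut A" "\<rho>' \<in> Aut A" "\<rho> ` P \<subseteq> Y \<and> \<rho>' ` P \<subseteq> Y"
      define c where "c \<rho> = restrict (\<lambda>n. to_nat (\<rho> (from_nat n))) (to_nat ` P)" for \<rho> :: "'a \<Rightarrow> 'a"
      define d where "d \<rho> = compose (univ (nat_copy P)) e (c \<rho>)" for \<rho>
      have c: "c \<rho> \<in> embeddings (nat_copy P) (nat_copy Y)" if "\<rho> \<in> Aut A" "\<rho> ` P \<subseteq> Y" for \<rho>
        unfolding c_def using that by (rule Aut_embedding_nat_copy)
      have *: "\<chi> (ext (d \<rho>)) = \<chi> (\<delta> \<circ> \<rho>)" if "\<rho> \<in> Aut A" "\<rho> ` P \<subseteq> Y" for \<rho>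
      proof -
        have d: "d \<rho> \<in> embeddings (nat_copy P) Z"
          unfolding d_def by (rule embeddings_compose[OF c[OF that] e])
        have "ext (d \<rho>) x = (\<delta> \<circ> \<rho>) x" if "x \<in> P" for x
        proof -
          have "ext (d \<rho>) x = z (d \<rho> (to_nat x))" using ext(2)[OF d] that by simp
          also have "\<dots> = z (e (to_nat (\<rho> x)))"
            using that by (simp add: d_def c_def compose_def nat_copy_def)
          also have "\<dots> = (\<delta> \<circ> \<rho>) x" using that \<open>\<rho> ` P \<subseteq> Y\<close> \<delta>(2) by auto
          finally show ?thesis .
        qed
        then show ?thesis
          using \<chi> determined_onD ext(1)[OF d] Aut_comp[OF \<delta>(1) \<open>\<rho> \<in> Aut A\<close>] by blast
      qed
      have "h (\<chi> (ext (d \<rho>))) = h (\<chi> (ext (d \<rho>')))"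
        unfolding d_def using mono c \<rho> by blast
      then have "\<chi> (ext (d \<rho>)) = \<chi> (ext (d \<rho>'))"
        using inj_onD[OF bij_betw_imp_inj_on[OF h]] \<chi> by blast
      then show "\<chi> (\<delta> \<circ> \<rho>) = \<chi> (\<delta> \<circ> \<rho>')" using * \<rho> by simp
    qed
    ultimately show "\<exists>\<delta> \<in> Aut A. \<delta> ` Y \<subseteq> z ` univ Z \<and> homogenises \<delta> P Y \<chi>"
      using \<delta>(1) by blast
  qed
qed

text \<open>
  Several colourings, for different finite sets \<open>P\<close>, are made constant one after the other: the set
  \<open>X\<close> is first enlarged to a set \<open>Y\<close> that works for all sets but one.
\<close>

lemma ramsey_family:
  fixes K :: "'k set"
  assumes "finite \<P>" and "\<forall>P \<in> \<P>. finite P" and "finite X" and "finite K"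
  shows "\<exists>Z. finite Z \<and> (\<forall>\<chi>. (\<forall>P \<in> \<P>. determined_on P (\<chi> P) \<and> range (\<chi> P) \<subseteq> K) \<longrightarrow>
    (\<exists>\<delta> \<in> Aut A. \<delta> ` X \<subseteq> Z \<and> (\<forall>P \<in> \<P>. homogenises \<delta> P X (\<chi> P))))"
  using assms(1,2)
proof (induction \<P> rule: finite_induct)
  case empty
  show ?case
    using \<open>finite X\<close> by (intro exI[of _ X]) (auto intro!: bexI[OF _ Aut_id])
next
  case (insert P \<P>)
  then obtain Y where "finite Y"
    and Y: "\<And>\<chi>. \<forall>P \<in> \<P>. determined_on P (\<chi> P) \<and> range (\<chi> P) \<subseteq> K \<Longrightarrow>
      \<exists>\<delta> \<in> Aut A. \<delta> ` X \<subseteq> Y \<and> (\<forall>P \<in> \<P>. homogenises \<delta> P X (\<chi> P))"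
    by (metis insertCI)
  obtain Z where "finite Z"
    and Z: "\<And>\<chi>. determined_on P \<chi> \<and> range \<chi> \<subseteq> K \<Longrightarrow>
      \<exists>\<delta> \<in> Aut A. \<delta> ` Y \<subseteq> Z \<and> homogenises \<delta> P Y \<chi>"
    using ramsey_single[OF bspec[OF insert.prems insertI1] \<open>finite Y\<close> \<open>finite K\<close>] by meson
  show ?case
  proof (intro exI[of _ Z] conjI allI impI)
    fix \<chi> :: "'a set \<Rightarrow> ('a \<Rightarrow> 'a) \<Rightarrow> 'k"
    assume \<chi>: "\<forall>P \<in> insert P \<P>. determined_on P (\<chi> P) \<and> range (\<chi> P) \<subseteq> K"
    then obtain \<delta>1 where \<delta>1: "\<delta>1 \<in> Aut A" "\<delta>1 ` Y \<subseteq> Z" "homogenises \<delta>1 P Y (\<chi> P)"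
      using Z[of "\<chi> P"] by blast
    let ?\<chi> = "\<lambda>P \<rho>. \<chi> P (\<delta>1 \<circ> \<rho>)"
    have "determined_on P (?\<chi> P) \<and> range (?\<chi> P) \<subseteq> K" if "P \<in> \<P>" for P
    proof
      show "determined_on P (?\<chi> P)"
        unfolding determined_on_def
      proof (intro ballI impI)
        fix \<rho> \<rho>' assume "\<rho> \<in> Aut A" "\<rho>' \<in> Aut A" "\<forall>x \<in> P. \<rho> x = \<rho>' x"
        then show "\<chi> P (\<delta>1 \<circ> \<rho>) = \<chi> P (\<delta>1 \<circ> \<rho>')"
          using \<chi> that \<delta>1(1) by (intro determined_onD[of P "\<chi> P"]) auto
      qed
      have "range (\<chi> P) \<subseteq> K" using \<chi> that by blast
      then show "range (?\<chi> P) \<subseteq> K" by blast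
    qed
    then obtain \<delta>2 where \<delta>2: "\<delta>2 \<in> Aut A" "\<delta>2 ` X \<subseteq> Y" "\<forall>P \<in> \<P>. homogenises \<delta>2 P X (?\<chi> P)"
      using Y[of ?\<chi>] by blast
    have "homogenises (\<delta>1 \<circ> \<delta>2) P X (\<chi> P)"
      unfolding homogenises_def comp_assoc
      using \<delta>2 by (intro ballI impI homogenisesD[OF \<delta>1(3)]) (auto simp: image_subset_iff)
    moreover have "homogenises (\<delta>1 \<circ> \<delta>2) Q X (\<chi> Q)" if "Q \<in> \<P>" for Q
      using \<delta>2(3) that unfolding homogenises_def comp_assoc by blast
    moreover have "(\<delta>1 \<circ> \<delta>2) ` X \<subseteq> Z" using \<delta>1(2) \<delta>2(2) by auto
    ultimately show "\<exists>\<delta> \<in> Aut A. \<delta> ` X \<subseteq> Z \<and> (\<forall>P \<in> insert P \<P>. homogenises \<delta> P X (\<chi> P))"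
      using \<delta>1(1) \<delta>2(1) by (intro bexI[of _ "\<delta>1 \<circ> \<delta>2"]) auto
  qed (fact \<open>finite Z\<close>)
qed

section \<open>Independent copies and canonisation\<close>

text \<open>
  A finite form of the existence of an invariant type: for every \<open>\<rho>\<close> that maps \<open>F\<close> into \<open>Y\<close>, the set
  \<open>\<rho>(F)\<close> has the same type over \<open>\<gamma>(F)\<close> as \<open>F\<close>.  Colour the copies of \<open>F\<close> by their type over \<open>F\<close>
  and take for \<open>\<gamma>\<close> the inverse of an automorphism that makes all copies of \<open>F\<close> inside \<open>Y\<close> look alike.
\<close>

lemma independent_copy:
  assumes "finite F" and "finite Y"
  shows "\<exists>\<gamma> \<in> Aut A. \<forall>\<rho> \<in> Aut A. \<rho> ` F \<subseteq> Y \<longrightarrow>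
    (\<exists>\<sigma> \<in> Aut A. (\<forall>x \<in> F. \<sigma> x = \<rho> x) \<and> (\<forall>x \<in> F. \<sigma> (\<gamma> x) = \<gamma> x))"
proof -
  define \<chi> where "\<chi> \<rho> = atomic_type (F <+> F) (case_sum \<rho> (\<lambda>x. x))" for \<rho>
  have fin: "finite (F <+> F)" using \<open>finite F\<close> by simp
  have "determined_on F \<chi>"
    unfolding determined_on_def \<chi>_def by (intro ballI impI atomic_type_cong) auto
  moreover have "range \<chi> \<subseteq> {atomic_type T \<phi> | T \<phi>. T \<subseteq> F <+> F}"
    unfolding \<chi>_def by blast
  ultimately obtain \<delta> where \<delta>: "\<delta> \<in> Aut A" and hom: "homogenises \<delta> F (F \<union> Y) \<chi>"
    \<comment> \<open>\<open>F\<close> is added to \<open>Y\<close> so that the identity is among the copies to be compared\<close>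
    using ramsey_single[OF \<open>finite F\<close> _ finite_atomic_types[OF fin], of "F \<union> Y"] assms
    by (meson finite_UnI)
  have "\<exists>\<sigma> \<in> Aut A. (\<forall>x \<in> F. \<sigma> x = \<rho> x) \<and> (\<forall>x \<in> F. \<sigma> (inv \<delta> x) = inv \<delta> x)"
    if \<rho>: "\<rho> \<in> Aut A" "\<rho> ` F \<subseteq> Y" for \<rho>
  proof -
    have "\<chi> (\<delta> \<circ> id) = \<chi> (\<delta> \<circ> \<rho>)"
      by (rule homogenisesD[OF hom Aut_id \<rho>(1)]) (use \<rho>(2) in auto)
    from atomic_type_eqD[OF fin this[unfolded \<chi>_def]]
    obtain \<tau> where "\<tau> \<in> Aut A"
      and \<tau>: "\<forall>s \<in> F <+> F. case_sum (\<delta> \<circ> \<rho>) (\<lambda>x. x) s = \<tau> (case_sum (\<delta> \<circ> id) (\<lambda>x. x) s)"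
      by blast
    have "\<tau> (\<delta> x) = \<delta> (\<rho> x)" "\<tau> x = x" if "x \<in> F" for x
      using bspec[OF \<tau> InlI[OF that]] bspec[OF \<tau> InrI[OF that]] by simp_all
    then show ?thesis
      using \<delta> \<open>\<tau> \<in> Aut A\<close> by (intro bexI[of _ "inv \<delta> \<circ> \<tau> \<circ> \<delta>"]) auto
  qed
  then show ?thesis using \<delta> by blast
qed

text \<open>
  A product Ramsey argument for the colouring of pairs of copies \<open>(\<rho>(P), \<rho>'(Q))\<close> by the type of all values
  \<open>\<Phi> j (\<rho> x) (\<rho>' y)\<close>.  The two arguments are moved independently, by \<open>\<delta>\<close> and \<open>\<epsilon>\<close>; this yields canonicity,
  where a single automorphism would only give behaviour that depends on the joint type of the arguments.
\<close>

lemma canonisation: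
  fixes J :: "'j set"
  assumes "finite X" and "finite J"
  shows "\<exists>Z. finite Z \<and> (\<forall>\<Phi>. \<exists>\<delta> \<in> Aut A. \<exists>\<epsilon> \<in> Aut A. \<delta> ` X \<subseteq> Z \<and> \<epsilon> ` X \<subseteq> Z \<and>
    (\<forall>j \<in> J. canonical_on X (\<lambda>x y. \<Phi> j (\<delta> x) (\<epsilon> y))))"
proof -
  define K1 where "K1 = {atomic_type T \<phi> | T \<phi>. T \<subseteq> J \<times> X \<times> X}"
  have "finite K1" unfolding K1_def using assms by (intro finite_atomic_types) auto
  have PowX: "finite (Pow X)" "\<forall>P \<in> Pow X. finite P"
    using \<open>finite X\<close> by (auto intro: finite_subset)
  from ramsey_family[OF PowX \<open>finite X\<close> \<open>finite K1\<close>]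
  obtain Z1 where "finite Z1"
    and Z1: "\<forall>\<chi>. (\<forall>P \<in> Pow X. determined_on P (\<chi> P) \<and> range (\<chi> P) \<subseteq> K1) \<longrightarrow>
      (\<exists>\<delta> \<in> Aut A. \<delta> ` X \<subseteq> Z1 \<and> (\<forall>P \<in> Pow X. homogenises \<delta> P X (\<chi> P)))"
    by (elim exE conjE) (rule that)
  define K2 where "K2 = Pow (SIGMA P : Pow X. (P \<rightarrow>\<^sub>E Z1) \<times> K1)"
  have "finite K2"
    unfolding K2_def using PowX \<open>finite Z1\<close> \<open>finite K1\<close> \<open>finite X\<close>
    by (intro iffD2[OF finite_Pow_iff] finite_SigmaI finite_PiE finite_cartesian_product) auto
  from ramsey_family[OF PowX \<open>finite X\<close> \<open>finite K2\<close>]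
  obtain Z2 where "finite Z2"
    and Z2: "\<forall>\<chi>. (\<forall>P \<in> Pow X. determined_on P (\<chi> P) \<and> range (\<chi> P) \<subseteq> K2) \<longrightarrow>
      (\<exists>\<delta> \<in> Aut A. \<delta> ` X \<subseteq> Z2 \<and> (\<forall>P \<in> Pow X. homogenises \<delta> P X (\<chi> P)))"
    by (elim exE conjE) (rule that)
  have "\<exists>\<delta> \<in> Aut A. \<exists>\<epsilon> \<in> Aut A. \<delta> ` X \<subseteq> Z1 \<union> Z2 \<and> \<epsilon> ` X \<subseteq> Z1 \<union> Z2 \<and>
    (\<forall>j \<in> J. canonical_on X (\<lambda>x y. \<Phi> j (\<delta> x) (\<epsilon> y)))" for \<Phi> :: "'j \<Rightarrow> 'a \<Rightarrow> 'a \<Rightarrow> 'a"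
  proof -
    define \<chi> where
      "\<chi> P Q \<rho> \<rho>' = atomic_type (J \<times> P \<times> Q) (\<lambda>(j, x, y). \<Phi> j (\<rho> x) (\<rho>' y))"
      for P Q :: "'a set" and \<rho> \<rho>'
    have \<chi>_cong: "\<chi> P Q \<rho> \<rho>' = \<chi> P Q \<sigma> \<sigma>'"
      if "\<And>x. x \<in> P \<Longrightarrow> \<rho> x = \<sigma> x" "\<And>y. y \<in> Q \<Longrightarrow> \<rho>' y = \<sigma>' y" for P Q \<rho> \<rho>' \<sigma> \<sigma>'
      unfolding \<chi>_def using that by (intro atomic_type_cong) auto
    have \<chi>_K1: "\<chi> P Q \<rho> \<rho>' \<in> K1" if "P \<subseteq> X" "Q \<subseteq> X" for P Q \<rho> \<rho>'
    proof -
      have "J \<times> P \<times> Q \<subseteq> J \<times> X \<times> X" using that by blast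
      then show ?thesis unfolding K1_def \<chi>_def by blast
    qed
    \<comment> \<open>one colour of \<open>\<rho>'\<close> records its behaviour with all copies of subsets of \<open>X\<close> inside \<open>Z1\<close>\<close>
    define \<chi>2 where "\<chi>2 Q \<rho>' = {(P, restrict \<rho> P, \<chi> P Q \<rho> \<rho>') | P \<rho>. P \<subseteq> X \<and> \<rho> ` P \<subseteq> Z1}" for Q \<rho>'
    have "determined_on Q (\<chi>2 Q) \<and> range (\<chi>2 Q) \<subseteq> K2" if "Q \<in> Pow X" for Q
    proof
      have "\<chi>2 Q \<rho> = \<chi>2 Q \<rho>'" if "\<forall>y \<in> Q. \<rho> y = \<rho>' y" for \<rho> \<rho>'
      proof -
        have "\<chi> P Q \<sigma> \<rho> = \<chi> P Q \<sigma> \<rho>'" for P \<sigma> using that by (intro \<chi>_cong) auto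
        then show ?thesis unfolding \<chi>2_def by simp
      qed
      then show "determined_on Q (\<chi>2 Q)" unfolding determined_on_def by blast
      show "range (\<chi>2 Q) \<subseteq> K2"
      proof (intro image_subsetI, unfold K2_def, intro PowI subsetI)
        fix \<rho>' t assume "t \<in> \<chi>2 Q \<rho>'"
        then obtain P \<rho> where t: "t = (P, restrict \<rho> P, \<chi> P Q \<rho> \<rho>')" "P \<subseteq> X" "\<rho> ` P \<subseteq> Z1"
          unfolding \<chi>2_def by blast
        then have "restrict \<rho> P \<in> P \<rightarrow>\<^sub>E Z1" by auto
        with t \<chi>_K1 that show "t \<in> (SIGMA P : Pow X. (P \<rightarrow>\<^sub>E Z1) \<times> K1)" by simp
      qed
    qed
    then have "\<forall>P \<in> Pow X. determined_on P (\<chi>2 P) \<and> range (\<chi>2 P) \<subseteq> K2" by (rule ballI)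
    from mp[OF spec[OF Z2] this]
    obtain \<epsilon> where \<epsilon>: "\<epsilon> \<in> Aut A" "\<epsilon> ` X \<subseteq> Z2"
      and \<epsilon>_hom: "\<forall>P \<in> Pow X. homogenises \<epsilon> P X (\<chi>2 P)"
      by (elim bexE conjE) (rule that)
    \<comment> \<open>the colours no longer depend on the copy in the second argument, so \<open>\<epsilon>\<close> itself represents them all\<close>
    define \<chi>1 where "\<chi>1 P \<rho> = \<chi> P X \<rho> \<epsilon>" for P \<rho>
    have "determined_on P (\<chi>1 P) \<and> range (\<chi>1 P) \<subseteq> K1" if "P \<in> Pow X" for P
      unfolding determined_on_def \<chi>1_def using that
      by (intro conjI ballI impI \<chi>_cong image_subsetI \<chi>_K1) auto
    then have "\<forall>P \<in> Pow X. determined_on P (\<chi>1 P) \<and> range (\<chi>1 P) \<subseteq> K1" by (rule ballI)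
    from mp[OF spec[OF Z1] this]
    obtain \<delta> where \<delta>: "\<delta> \<in> Aut A" "\<delta> ` X \<subseteq> Z1"
      and \<delta>_hom: "\<forall>P \<in> Pow X. homogenises \<delta> P X (\<chi>1 P)"
      by (elim bexE conjE) (rule that)
    have "canonical_on X (\<lambda>x y. \<Phi> j (\<delta> x) (\<epsilon> y))" if "j \<in> J" for j
      unfolding canonical_on_def
    proof (intro ballI)
      fix \<rho> \<rho>' assume \<rho>: "\<rho> \<in> Aut A" "\<rho>' \<in> Aut A"
      define P where "P = {x \<in> X. \<rho> x \<in> X}"
      define Q where "Q = {x \<in> X. \<rho>' x \<in> X}"
      have sub: "P \<subseteq> X" "Q \<subseteq> X" "\<rho> ` P \<subseteq> X" "\<rho>' ` Q \<subseteq> X"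
        by (auto simp: P_def Q_def)
      then have fin: "finite (J \<times> P \<times> X)" "finite (J \<times> P \<times> Q)"
        using assms by (auto intro: finite_subset)
      have "\<chi>1 P (\<delta> \<circ> id) = \<chi>1 P (\<delta> \<circ> \<rho>)"
        by (rule homogenisesD[OF bspec[OF \<delta>_hom]]) (use sub \<rho> in auto)
      from atomic_type_eqD[OF fin(1) this[unfolded \<chi>1_def \<chi>_def]]
      obtain \<tau>1 where \<tau>1: "\<tau>1 \<in> Aut A"
        "\<forall>s \<in> J \<times> P \<times> X. (case s of (j, x, y) \<Rightarrow> \<Phi> j ((\<delta> \<circ> \<rho>) x) (\<epsilon> y)) =
           \<tau>1 (case s of (j, x, y) \<Rightarrow> \<Phi> j ((\<delta> \<circ> id) x) (\<epsilon> y))" by blast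
      have "\<chi>2 Q (\<epsilon> \<circ> id) = \<chi>2 Q (\<epsilon> \<circ> \<rho>')"
        by (rule homogenisesD[OF bspec[OF \<epsilon>_hom]]) (use sub \<rho> in auto)
      moreover have "(P, restrict (\<delta> \<circ> \<rho>) P, \<chi> P Q (\<delta> \<circ> \<rho>) (\<epsilon> \<circ> id)) \<in> \<chi>2 Q (\<epsilon> \<circ> id)"
      proof -
        have "(\<delta> \<circ> \<rho>) ` P \<subseteq> Z1" using sub(3) \<delta>(2) by auto
        with sub(1) show ?thesis unfolding \<chi>2_def by blast
      qed
      ultimately have "(P, restrict (\<delta> \<circ> \<rho>) P, \<chi> P Q (\<delta> \<circ> \<rho>) (\<epsilon> \<circ> id)) \<in> \<chi>2 Q (\<epsilon> \<circ> \<rho>')"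
        by simp
      then obtain \<sigma> where \<sigma>: "restrict (\<delta> \<circ> \<rho>) P = restrict \<sigma> P"
        "\<chi> P Q (\<delta> \<circ> \<rho>) (\<epsilon> \<circ> id) = \<chi> P Q \<sigma> (\<epsilon> \<circ> \<rho>')"
        unfolding \<chi>2_def by blast
      have "\<sigma> x = (\<delta> \<circ> \<rho>) x" if "x \<in> P" for x
        using fun_cong[OF \<sigma>(1), of x] that by simp
      then have "\<chi> P Q \<sigma> (\<epsilon> \<circ> \<rho>') = \<chi> P Q (\<delta> \<circ> \<rho>) (\<epsilon> \<circ> \<rho>')"
        by (intro \<chi>_cong) auto
      with \<sigma>(2) have "\<chi> P Q (\<delta> \<circ> \<rho>) (\<epsilon> \<circ> id) = \<chi> P Q (\<delta> \<circ> \<rho>) (\<epsilon> \<circ> \<rho>')" by simp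
      from atomic_type_eqD[OF fin(2) this[unfolded \<chi>_def]]
      obtain \<tau>2 where \<tau>2: "\<tau>2 \<in> Aut A"
        "\<forall>s \<in> J \<times> P \<times> Q. (case s of (j, x, y) \<Rightarrow> \<Phi> j ((\<delta> \<circ> \<rho>) x) ((\<epsilon> \<circ> \<rho>') y)) =
           \<tau>2 (case s of (j, x, y) \<Rightarrow> \<Phi> j ((\<delta> \<circ> \<rho>) x) ((\<epsilon> \<circ> id) y))" by blast
      have "\<Phi> j (\<delta> (\<rho> x)) (\<epsilon> (\<rho>' y)) = (\<tau>2 \<circ> \<tau>1) (\<Phi> j (\<delta> x) (\<epsilon> y))"
        if "x \<in> P" "y \<in> Q" for x y
        using bspec[OF \<tau>1(2), of "(j, x, y)"] bspec[OF \<tau>2(2), of "(j, x, y)"] that sub \<open>j \<in> J\<close>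
        by auto
      then show "\<exists>\<tau> \<in> Aut A. \<forall>x \<in> X. \<forall>y \<in> X. \<rho> x \<in> X \<longrightarrow> \<rho>' y \<in> X \<longrightarrow>
          \<Phi> j (\<delta> (\<rho> x)) (\<epsilon> (\<rho>' y)) = \<tau> (\<Phi> j (\<delta> x) (\<epsilon> y))"
        using \<tau>1(1) \<tau>2(1) by (intro bexI[of _ "\<tau>2 \<circ> \<tau>1"]) (auto simp: P_def Q_def)
    qed
    then show ?thesis using \<delta> \<epsilon> by blast
  qed
  then show ?thesis using \<open>finite Z1\<close> \<open>finite Z2\<close> by (intro exI[of _ "Z1 \<union> Z2"]) auto
qed

end

section \<open>Polymorphisms and canonical operations\<close>

lemma arity_mk_op [simp]: "arity (mk_op k F) = k"
  by (simp add: mk_op_def)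

lemma app_mk_op [simp]: "length xs = k \<Longrightarrow> app (mk_op k F) xs = F xs"
  by (simp add: mk_op_def tuples_def)

lemma mk_op_cong: "(\<And>xs. length xs = k \<Longrightarrow> F xs = G xs) \<Longrightarrow> mk_op k F = mk_op k G"
  by (auto simp: mk_op_def tuples_def restrict_def)

definition binary :: "('a \<Rightarrow> 'a \<Rightarrow> 'a) \<Rightarrow> 'a operation" where
  "binary F = mk_op 2 (\<lambda>xs. F (xs ! 0) (xs ! 1))"

lemma arity_binary [simp]: "arity (binary F) = 2"
  by (simp add: binary_def)

lemma length_2_conv: "length xs = 2 \<longleftrightarrow> (\<exists>x y. xs = [x, y])"
  by (auto simp: numeral_2_eq_2 length_Suc_conv)

lemma map2_eq_map_nth: "length vs = n \<Longrightarrow> length xs = n \<Longrightarrow>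
    map2 (\<lambda>v x. v x) vs xs = map (\<lambda>i. (vs ! i) (xs ! i)) [0..<n]"
  by (intro nth_equalityI) auto

context finitely_homogeneous_structure
begin

text \<open>
  Canonicity in terms of automorphisms.  Listing the finite set \<open>E\<close> of arguments turns it into one tuple
  for each position, so that the definition applies.
\<close>

lemma canonicalD:
  assumes can: "canonical A f" and v: "\<And>i. i < arity f \<Longrightarrow> v i \<in> Aut A" and "finite E"
    and E: "\<And>xs. xs \<in> E \<Longrightarrow> length xs = arity f"
  shows "\<exists>\<tau> \<in> Aut A. \<forall>xs \<in> E. app f (map (\<lambda>i. v i (xs ! i)) [0..<arity f]) = \<tau> (app f xs)"
proof -
  obtain L where L: "set L = E" using \<open>finite E\<close> finite_list by blast
  define as where "as = map (\<lambda>i. map (\<lambda>xs. xs ! i) L) [0..<arity f]"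
  define bs where "bs = map (\<lambda>i. map (\<lambda>xs. v i (xs ! i)) L) [0..<arity f]"
  have "as ! i \<in> tuples (length L) (univ A)" "fo_type A (as ! i) = fo_type A (bs ! i)"
    if "i < arity f" for i
  proof -
    have "bs ! i = map (v i) (as ! i)" using that by (simp add: as_def bs_def)
    then show "fo_type A (as ! i) = fo_type A (bs ! i)"
      using v[OF that] by (subst fo_type_eq_iff) auto
  qed (use that in \<open>auto simp: as_def tuples_def\<close>)
  moreover have "as \<in> tuples (arity f) (tuples (length L) (univ A))"
    "bs \<in> tuples (arity f) (tuples (length L) (univ A))"
    by (auto simp: as_def bs_def tuples_def)
  ultimately have "fo_type A (componentwise f (length L) as) = fo_type A (componentwise f (length L) bs)"
    using can unfolding canonical_def by blast
  then obtain \<tau> where \<tau>: "\<tau> \<in> Aut A" "componentwise f (length L) bs = map \<tau> (componentwise f (length L) as)"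
    by (subst (asm) fo_type_eq_iff) (auto simp: componentwise_def)
  have "app f (map (\<lambda>i. v i (xs ! i)) [0..<arity f]) = \<tau> (app f xs)" if "xs \<in> E" for xs
  proof -
    obtain j where j: "j < length L" "xs = L ! j" using \<open>xs \<in> E\<close> L by (metis in_set_conv_nth)
    have "map (\<lambda>a. a ! j) as = map (\<lambda>i. xs ! i) [0..<length xs]"
      using j E[OF that] by (simp add: as_def)
    then have "map (\<lambda>a. a ! j) as = xs" by (simp only: map_nth)
    moreover have "map (\<lambda>a. a ! j) bs = map (\<lambda>i. v i (xs ! i)) [0..<arity f]"
      using j by (simp add: bs_def)
    moreover have "componentwise f (length L) bs ! j = \<tau> (componentwise f (length L) as ! j)"
      unfolding \<tau>(2) using j(1) by (simp add: componentwise_def)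
    ultimately show ?thesis
      using j(1) by (simp add: componentwise_def)
  qed
  then show ?thesis using \<tau>(1) by blast
qed

lemma canonical_binaryI:
  assumes "\<And>X. finite X \<Longrightarrow> canonical_on X F"
  shows "canonical A (binary F)"
  unfolding canonical_def
proof (intro allI ballI impI)
  fix n and as bs :: "'a list list"
  assume "as \<in> tuples (arity (binary F)) (tuples n (univ A))"
    "bs \<in> tuples (arity (binary F)) (tuples n (univ A))"
  then obtain a a' b b' where ab: "as = [a, a']" "bs = [b, b']"
    and len: "length a = n" "length a' = n" "length b = n" "length b' = n"
    by (auto simp: tuples_def length_2_conv)
  assume "\<forall>i < arity (binary F). fo_type A (as ! i) = fo_type A (bs ! i)"
  then have "fo_type A (as ! 0) = fo_type A (bs ! 0)" "fo_type A (as ! 1) = fo_type A (bs ! 1)"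
    by simp_all
  then obtain \<rho> \<rho>' where \<rho>: "\<rho> \<in> Aut A" "b = map \<rho> a" "\<rho>' \<in> Aut A" "b' = map \<rho>' a'"
    using len by (auto simp: ab fo_type_eq_iff)
  let ?X = "set a \<union> set a' \<union> set b \<union> set b'"
  have "canonical_on ?X F" by (intro assms) simp
  from canonical_onD[OF this \<rho>(1,3)] obtain \<tau> where \<tau>: "\<tau> \<in> Aut A"
    "\<forall>x \<in> ?X. \<forall>y \<in> ?X. \<rho> x \<in> ?X \<longrightarrow> \<rho>' y \<in> ?X \<longrightarrow> F (\<rho> x) (\<rho>' y) = \<tau> (F x y)" ..
  have comp: "componentwise (binary F) n [a, a'] = map (\<lambda>j. F (a ! j) (a' ! j)) [0..<n]"
    for a a' :: "'a list"
    by (simp add: componentwise_def binary_def)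
  have "componentwise (binary F) n bs = map \<tau> (componentwise (binary F) n as)"
    unfolding ab comp using \<tau>(2) len by (simp add: \<rho>(2,4))
  then show "fo_type A (componentwise (binary F) n as) = fo_type A (componentwise (binary F) n bs)"
    using \<tau>(1) by (subst fo_type_eq_iff) (auto simp: componentwise_def)
qed

lemma Aut_closureI:
  assumes "\<And>F. finite F \<Longrightarrow> \<exists>\<alpha> \<in> Aut A. \<forall>x \<in> F. u x = \<alpha> x"
  shows "u \<in> Aut_closure A"
  using assms by (auto simp: Aut_closure_def)

lemma Aut_closureD:
  "u \<in> Aut_closure A \<Longrightarrow> finite F \<Longrightarrow> \<exists>\<alpha> \<in> Aut A. \<forall>x \<in> F. u x = \<alpha> x"
  by (simp add: Aut_closure_def)

lemma id_in_Aut_closure: "id \<in> Aut_closure A"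
  by (intro Aut_closureI bexI[OF _ Aut_id]) simp

end

locale ramsey_reduct = ramsey_structure A
  for A :: "('r, 'a::countable) struct" +
  fixes C :: "('s, 'a) struct"
  assumes reduct: "reduct C A"
begin

lemma univ_C [simp]: "univ C = UNIV"
  using reduct by (simp add: reduct_def)

lemma Aut_rel_reduct:
  assumes "\<tau> \<in> Aut A" and "signat C r = Some (length xs)"
  shows "map \<tau> xs \<in> rel C r \<longleftrightarrow> xs \<in> rel C r"
proof -
  obtain \<phi> where \<phi>: "\<phi> \<in> formulas (signat A) (length xs)"
    and def: "\<forall>ys \<in> tuples (length xs) (univ A). ys \<in> rel C r \<longleftrightarrow> sat A (\<lambda>i. ys ! i) \<phi>"
    using reduct assms(2) unfolding reduct_def by blast
  show ?thesis
    using def sat_list_Aut[OF assms(1) \<phi>] by (simp add: tuples_def)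
qed

lemma PolD:
  assumes "f \<in> Pol C" and "signat C r = Some (length ts)"
    and "\<And>t. t \<in> set ts \<Longrightarrow> length t = arity f"
    and "\<And>i. i < arity f \<Longrightarrow> map (\<lambda>t. t ! i) ts \<in> rel C r"
  shows "map (app f) ts \<in> rel C r"
proof -
  have "ts \<in> tuples (length ts) (tuples (arity f) UNIV)"
    using assms(3) by (auto simp: tuples_def)
  then show ?thesis
    using assms(1,2,4) by (auto simp: Pol_def homs_def power_struct_def)
qed

text \<open>
  Preserving a relation involves finitely many arguments at a time.  So an operation is a polymorphism
  if locally it arises from polymorphisms by identifying arguments and by composition with
  automorphisms.  This covers limits, minors and composition with elements of the closure.
\<close>

lemma Pol_locally:
  assumes "k \<ge> 1"
    and loc: "\<And>E. finite E \<Longrightarrow> \<exists>g \<in> Pol C. \<exists>\<tau> \<in> Aut A. \<exists>v c.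
      (\<forall>i < arity g. v i \<in> Aut A \<and> c i < k) \<and>
      (\<forall>xs \<in> E. length xs = k \<longrightarrow> F xs = \<tau> (app g (map (\<lambda>i. v i (xs ! c i)) [0..<arity g])))"
  shows "mk_op k F \<in> Pol C"
proof -
  have "map (restrict F (tuples k UNIV)) ts \<in> rel C r"
    if r: "signat C r = Some n" and ts: "ts \<in> tuples n (tuples k UNIV)"
      and rel: "\<forall>i<k. map (\<lambda>t. t ! i) ts \<in> rel C r" for r n ts
  proof -
    obtain g \<tau> v c where g: "g \<in> Pol C" and \<tau>: "\<tau> \<in> Aut A"
      and v: "\<And>i. i < arity g \<Longrightarrow> v i \<in> Aut A" and c: "\<And>i. i < arity g \<Longrightarrow> c i < k"
      and F: "\<forall>xs \<in> set ts. length xs = k \<longrightarrow> F xs = \<tau> (app g (map (\<lambda>i. v i (xs ! c i)) [0..<arity g]))"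
      using loc[of "set ts"] by blast
    define T where "T = map (\<lambda>xs. map (\<lambda>i. v i (xs ! c i)) [0..<arity g]) ts"
    have len: "length ts = n" "\<And>t. t \<in> set ts \<Longrightarrow> length t = k"
      using ts by (auto simp: tuples_def)
    have "map (app g) T \<in> rel C r"
    proof (rule PolD[OF g])
      fix i assume i: "i < arity g"
      have "map (v i) (map (\<lambda>t. t ! c i) ts) \<in> rel C r"
        using Aut_rel_reduct[OF v[OF i], of r "map (\<lambda>t. t ! c i) ts"] r len(1) rel c[OF i]
        by (simp del: map_map)
      then show "map (\<lambda>t. t ! i) T \<in> rel C r" using i by (simp add: T_def comp_def)
    qed (use r len in \<open>auto simp: T_def\<close>)
    then have "map \<tau> (map (app g) T) \<in> rel C r"
      using Aut_rel_reduct[OF \<tau>, of r "map (app g) T"] r len(1) by (simp add: T_def)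
    moreover have "map \<tau> (map (app g) T) = map (restrict F (tuples k UNIV)) ts"
      using F len(2) by (simp add: T_def tuples_def)
    ultimately show ?thesis by simp
  qed
  then show ?thesis
    using \<open>k \<ge> 1\<close> by (simp add: Pol_def homs_def power_struct_def mk_op_def)
qed

lemma Pol_binary_locally:
  assumes "\<And>X. finite X \<Longrightarrow> \<exists>G \<tau>. binary G \<in> Pol C \<and> \<tau> \<in> Aut A \<and>
    (\<forall>x \<in> X. \<forall>y \<in> X. F x y = \<tau> (G x y))"
  shows "binary F \<in> Pol C"
  unfolding binary_def
proof (rule Pol_locally)
  fix E :: "'a list set" assume "finite E"
  define X where "X = \<Union> (set ` E)"
  have "finite X" using \<open>finite E\<close> by (simp add: X_def)
  then obtain G \<tau> where G: "binary G \<in> Pol C" "\<tau> \<in> Aut A" "\<forall>x \<in> X. \<forall>y \<in> X. F x y = \<tau> (G x y)"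
    using assms by blast
  have "F (xs ! 0) (xs ! 1) = \<tau> (app (binary G) (map (\<lambda>i. id (xs ! id i)) [0..<2]))"
    if "xs \<in> E" "length xs = 2" for xs
  proof -
    obtain x y where "xs = [x, y]" using \<open>length xs = 2\<close> by (auto simp: length_2_conv)
    moreover from this \<open>xs \<in> E\<close> have "x \<in> X" "y \<in> X" unfolding X_def by (auto intro: rev_bexI)
    ultimately show ?thesis using G(3) by (simp add: binary_def)
  qed
  then show "\<exists>g \<in> Pol C. \<exists>\<tau> \<in> Aut A. \<exists>v c. (\<forall>i < arity g. v i \<in> Aut A \<and> c i < 2) \<and>
      (\<forall>xs \<in> E. length xs = 2 \<longrightarrow>
        F (xs ! 0) (xs ! 1) = \<tau> (app g (map (\<lambda>i. v i (xs ! c i)) [0..<arity g])))"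
    using G(1,2) by (intro bexI[OF _ G(1)] bexI[OF _ G(2)] exI[of _ "\<lambda>_. id"] exI[of _ id]) auto
qed simp

lemma Pol_binary_minor:
  assumes "f \<in> Pol C" and "\<And>i. i < arity f \<Longrightarrow> v i \<in> Aut A" and "\<And>i. i < arity f \<Longrightarrow> c i < 2"
  shows "binary (\<lambda>x y. app f (map (\<lambda>i. v i ([x, y] ! c i)) [0..<arity f])) \<in> Pol C"
  unfolding binary_def
proof (rule Pol_locally)
  fix E :: "'a list set"
  show "\<exists>g \<in> Pol C. \<exists>\<tau> \<in> Aut A. \<exists>v' c'. (\<forall>i < arity g. v' i \<in> Aut A \<and> c' i < 2) \<and>
      (\<forall>xs \<in> E. length xs = 2 \<longrightarrow>
        app f (map (\<lambda>i. v i ([xs ! 0, xs ! 1] ! c i)) [0..<arity f]) =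
          \<tau> (app g (map (\<lambda>i. v' i (xs ! c' i)) [0..<arity g])))"
    using assms(2,3)
    by (intro bexI[OF _ assms(1)] bexI[OF _ Aut_id] exI[of _ v] exI[of _ c])
      (auto simp: length_2_conv)
qed simp

lemma Pol_binary_swap:
  assumes "binary F \<in> Pol C"
  shows "binary (\<lambda>x y. F y x) \<in> Pol C"
  using Pol_binary_minor[OF assms, of "\<lambda>_. id" "\<lambda>i. 1 - i"]
  by (simp add: binary_def numeral_2_eq_2 cong: map_cong)

lemma Pol_binary_Aut_closure:
  assumes F: "binary F \<in> Pol C" and u: "u \<in> Aut_closure A" and v: "v \<in> Aut_closure A"
  shows "binary (\<lambda>x y. F (u x) (v y)) \<in> Pol C"
proof (rule Pol_binary_locally)
  fix X :: "'a set" assume "finite X"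
  from Aut_closureD[OF u this] obtain \<alpha> where \<alpha>: "\<alpha> \<in> Aut A" "\<forall>x \<in> X. u x = \<alpha> x" ..
  from Aut_closureD[OF v \<open>finite X\<close>] obtain \<beta> where \<beta>: "\<beta> \<in> Aut A" "\<forall>x \<in> X. v x = \<beta> x" ..
  have "binary (\<lambda>x y. F (\<alpha> x) (\<beta> y)) \<in> Pol C"
    using Pol_binary_minor[OF F, of "\<lambda>i. if i = 0 then \<alpha> else \<beta>" id] \<alpha>(1) \<beta>(1)
    by (simp add: binary_def numeral_2_eq_2)
  then show "\<exists>G \<tau>. binary G \<in> Pol C \<and> \<tau> \<in> Aut A \<and> (\<forall>x \<in> X. \<forall>y \<in> X. F (u x) (v y) = \<tau> (G x y))"
    using \<alpha>(2) \<beta>(2) by (intro exI[of _ "\<lambda>x y. F (\<alpha> x) (\<beta> y)"] exI[of _ id]) auto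
qed

end

section \<open>Linked polymorphisms\<close>

lemma outer_inner_binary:
  "outer e (inner (binary F) [u, v]) = binary (\<lambda>x y. e (F (u x) (v y)))"
  unfolding outer_def inner_def binary_def
  by (auto intro!: mk_op_cong simp: length_2_conv)

lemma inner_binary: "inner (binary F) [u, v] = binary (\<lambda>x y. F (u x) (v y))"
  unfolding inner_def binary_def by (auto intro!: mk_op_cong simp: length_2_conv)

lemma minor_binary_swap: "minor (binary F) 2 (\<lambda>i. 1 - i) = binary (\<lambda>x y. F y x)"
  unfolding minor_def binary_def
  by (auto intro!: mk_op_cong simp: length_2_conv numeral_2_eq_2)

context finitely_homogeneous_structure
begin

text \<open>
  The two paths of the proof, for the family \<open>p\<close> of two binary operations, restricted to arguments
  from \<open>X\<close>.  The first index of \<open>U\<close> says which argument it is applied to; the second index distinguishes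
  the original copy (\<open>False\<close>) from the independent copy (\<open>True\<close>).  Each \<open>p b\<close> behaves like \<open>G b\<close> at the
  start of its path and is canonical at the later two stations, and the paths end in the same values.
\<close>

definition linked ::
  "(bool \<Rightarrow> 'a \<Rightarrow> 'a \<Rightarrow> 'a) \<Rightarrow> 'a set \<Rightarrow> (bool \<Rightarrow> 'a \<Rightarrow> 'a \<Rightarrow> 'a) \<Rightarrow> (bool \<Rightarrow> bool \<Rightarrow> 'a \<Rightarrow> 'a) \<Rightarrow> bool" where
  "linked G X p U \<longleftrightarrow>
     (\<forall>b. similar_on X (\<lambda>x y. p b (U False False x) (U True False y)) (G b) \<and>
          canonical_on X (\<lambda>x y. p b (U False False x) (U True True y)) \<and>
          canonical_on X (\<lambda>x y. p b (U False True x) (U True True y))) \<and>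
     (\<forall>x \<in> X. \<forall>y \<in> X. p True (U False True x) (U True True y) = p False (U False True x) (U True True y))"

lemma linked_subset: "linked G Y p U \<Longrightarrow> X \<subseteq> Y \<Longrightarrow> linked G X p U"
  unfolding linked_def by (meson similar_on_subset canonical_on_subset subsetD)

text \<open>
  Only the composed operations matter, and these only up to a common automorphism.  Therefore \<open>linked\<close>
  survives the passage to limits.
\<close>

lemma linked_transfer:
  assumes l: "linked G X p U" and "\<tau> \<in> Aut A"
    and eq: "\<And>b s t x y. x \<in> X \<Longrightarrow> y \<in> X \<Longrightarrow> p' b (U' False s x) (U' True t y) = \<tau> (p b (U False s x) (U True t y))"
  shows "linked G X p' U'"
proof -
  have *: "similar_on X (\<lambda>x y. p' b (U' False s x) (U' True t y)) (\<lambda>x y. p b (U False s x) (U True t y))"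
    for b s t
    unfolding similar_on_def using eq assms(2) by blast
  show ?thesis
    unfolding linked_def
  proof (intro conjI allI ballI)
    fix b
    show "similar_on X (\<lambda>x y. p' b (U' False False x) (U' True False y)) (G b)"
      by (rule similar_on_trans[OF *]) (use l in \<open>simp add: linked_def\<close>)
    show "canonical_on X (\<lambda>x y. p' b (U' False False x) (U' True True y))"
      by (rule canonical_on_similar[OF *]) (use l in \<open>simp add: linked_def\<close>)
    show "canonical_on X (\<lambda>x y. p' b (U' False True x) (U' True True y))"
      by (rule canonical_on_similar[OF *]) (use l in \<open>simp add: linked_def\<close>)
    fix x y assume "x \<in> X" "y \<in> X"
    with l show "p' True (U' False True x) (U' True True y) = p' False (U' False True x) (U' True True y)"
      by (simp add: eq linked_def)
  qed
qed

lemma canonical_minor_on: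
  assumes "canonical A g" and "finite X" and "\<And>i. i < arity g \<Longrightarrow> c i < 2"
  shows "canonical_on X (\<lambda>x y. app g (map (\<lambda>i. [x, y] ! c i) [0..<arity g]))"
  unfolding canonical_on_def
proof (intro ballI)
  fix \<rho> \<rho>' assume \<rho>: "\<rho> \<in> Aut A" "\<rho>' \<in> Aut A"
  define arg where "arg x y = map (\<lambda>i. [x, y] ! c i) [0..<arity g]" for x y :: 'a
  define v where "v i = [\<rho>, \<rho>'] ! c i" for i
  define E where "E = (\<lambda>(x, y). arg x y) ` (X \<times> X)"
  have c: "c i = 0 \<or> c i = 1" if "i < arity g" for i
    using assms(3)[OF that] by auto
  have "v i \<in> Aut A" if "i < arity g" for i
    using c[OF that] \<rho> by (auto simp: v_def)
  moreover have "finite E" using \<open>finite X\<close> by (simp add: E_def)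
  moreover have "length xs = arity g" if "xs \<in> E" for xs
    using that by (auto simp: E_def arg_def)
  ultimately have "\<exists>\<tau> \<in> Aut A. \<forall>xs \<in> E. app g (map (\<lambda>i. v i (xs ! i)) [0..<arity g]) = \<tau> (app g xs)"
    by (rule canonicalD[OF assms(1)])
  then obtain \<tau> where \<tau>: "\<tau> \<in> Aut A"
    "\<forall>xs \<in> E. app g (map (\<lambda>i. v i (xs ! i)) [0..<arity g]) = \<tau> (app g xs)" ..
  have arg: "map (\<lambda>i. v i (arg x y ! i)) [0..<arity g] = arg (\<rho> x) (\<rho>' y)" for x y
    unfolding arg_def v_def using c by (auto intro!: nth_equalityI) (metis nth_Cons_0 nth_Cons_Suc One_nat_def)
  have "app g (arg (\<rho> x) (\<rho>' y)) = \<tau> (app g (arg x y))" if "x \<in> X" "y \<in> X" for x y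
  proof -
    have "arg x y \<in> E" using that by (auto simp: E_def)
    from bspec[OF \<tau>(2) this] show ?thesis unfolding arg .
  qed
  then show "\<exists>\<tau> \<in> Aut A. \<forall>x \<in> X. \<forall>y \<in> X. \<rho> x \<in> X \<longrightarrow> \<rho>' y \<in> X \<longrightarrow>
      app g (map (\<lambda>i. [\<rho> x, \<rho>' y] ! c i) [0..<arity g]) = \<tau> (app g (map (\<lambda>i. [x, y] ! c i) [0..<arity g]))"
    using \<tau>(1) unfolding arg_def by blast
qed

end

context ramsey_reduct
begin

text \<open>
  The set \<open>Z\<close> comes from canonisation for \<open>X\<close> and is chosen before the automorphisms.
  Interpolation gives automorphisms \<open>\<alpha> b i\<close> with the behaviour of \<open>g b\<close> on \<open>Z\<close>, which are replaced by
  automorphisms \<open>\<sigma> b i\<close> that agree with them on \<open>Z\<close> and fix the independent copy \<open>\<gamma>(Z)\<close>.  Finally \<open>X\<close>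
  is moved into \<open>Z\<close> by \<open>\<delta>\<close> and \<open>\<epsilon>\<close>, one for each argument, to make the operations canonical.
\<close>

lemma linked_on_finite:
  assumes f: "f \<in> Pol C" and g: "\<And>b. canonical A (g b)"
    and interp: "\<And>b. interpolates (Aut A) f (g b)"
    and c: "\<And>i. i < arity f \<Longrightarrow> c i < 2" and "finite X"
  defines "G \<equiv> \<lambda>b x y. app (g b) (map (\<lambda>i. [x, y] ! c i) [0..<arity f])"
  shows "\<exists>p U. (\<forall>b. binary (p b) \<in> Pol C) \<and> (\<forall>s t. U s t \<in> Aut A) \<and> linked G X p U"
proof -
  have ar: "arity (g b) = arity f" for b
    using interp[of b] by (simp add: interpolates_def)
  define fam where "fam v x y = app f (map (\<lambda>i. v i ([x, y] ! c i)) [0..<arity f])"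
    for v and x y :: 'a
  obtain Z where "finite Z" and Z: "\<forall>\<Phi>. \<exists>\<delta> \<in> Aut A. \<exists>\<epsilon> \<in> Aut A. \<delta> ` X \<subseteq> Z \<and> \<epsilon> ` X \<subseteq> Z \<and>
      (\<forall>j \<in> (UNIV :: (bool \<times> bool) set). canonical_on X (\<lambda>x y. \<Phi> j (\<delta> x) (\<epsilon> y)))"
    using canonisation[OF \<open>finite X\<close>, of "UNIV :: (bool \<times> bool) set"] by auto
  have "\<exists>u \<alpha>. u \<in> Aut A \<and> (\<forall>i < arity f. \<alpha> i \<in> Aut A) \<and> (\<forall>x \<in> Z. \<forall>y \<in> Z. G b x y = u (fam \<alpha> x y))"
    for b
  proof -
    obtain u vs where u: "u \<in> Aut A" and vs: "vs \<in> tuples (arity f) (Aut A)"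
      and eq: "\<forall>xs \<in> tuples (arity f) Z. app (g b) xs = u (app f (map2 (\<lambda>v x. v x) vs xs))"
      using interp[of b] \<open>finite Z\<close> unfolding interpolates_def by blast
    have "G b x y = u (fam (\<lambda>i. vs ! i) x y)" if "x \<in> Z" "y \<in> Z" for x y
    proof -
      let ?xs = "map (\<lambda>i. [x, y] ! c i) [0..<arity f]"
      have "[x, y] ! c i \<in> Z" if "i < arity f" for i
        using c[OF that] \<open>x \<in> Z\<close> \<open>y \<in> Z\<close> by (auto simp: less_2_cases_iff)
      then have "?xs \<in> tuples (arity f) Z" by (auto simp: tuples_def)
      moreover have "map2 (\<lambda>v x. v x) vs ?xs = map (\<lambda>i. (vs ! i) ([x, y] ! c i)) [0..<arity f]"
        using vs by (subst map2_eq_map_nth[of _ "arity f"]) (auto simp: tuples_def)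
      ultimately show ?thesis using eq by (simp add: G_def fam_def)
    qed
    moreover have "\<forall>i < arity f. vs ! i \<in> Aut A" using vs by (auto simp: tuples_def)
    ultimately show ?thesis using u by blast
  qed
  then have "\<forall>b. \<exists>u \<alpha>. u \<in> Aut A \<and> (\<forall>i < arity f. \<alpha> i \<in> Aut A) \<and>
      (\<forall>x \<in> Z. \<forall>y \<in> Z. G b x y = u (fam \<alpha> x y))" ..
  from choice[OF this] obtain u where "\<forall>b. \<exists>\<alpha>. u b \<in> Aut A \<and> (\<forall>i < arity f. \<alpha> i \<in> Aut A) \<and>
      (\<forall>x \<in> Z. \<forall>y \<in> Z. G b x y = u b (fam \<alpha> x y))" ..
  from choice[OF this] obtain \<alpha> where *: "\<forall>b. u b \<in> Aut A \<and> (\<forall>i < arity f. \<alpha> b i \<in> Aut A) \<and>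
      (\<forall>x \<in> Z. \<forall>y \<in> Z. G b x y = u b (fam (\<alpha> b) x y))" ..
  then have u: "u b \<in> Aut A" and \<alpha>: "i < arity f \<Longrightarrow> \<alpha> b i \<in> Aut A"
    and G: "x \<in> Z \<Longrightarrow> y \<in> Z \<Longrightarrow> G b x y = u b (fam (\<alpha> b) x y)" for b i x y
    by blast+
  define Y where "Y = (\<Union>b. \<Union>i<arity f. \<alpha> b i ` Z)"
  have "finite Y" using \<open>finite Z\<close> by (simp add: Y_def)
  from independent_copy[OF \<open>finite Z\<close> this] obtain \<gamma> where \<gamma>: "\<gamma> \<in> Aut A"
    and indep: "\<forall>\<rho> \<in> Aut A. \<rho> ` Z \<subseteq> Y \<longrightarrow>
      (\<exists>\<sigma> \<in> Aut A. (\<forall>x \<in> Z. \<sigma> x = \<rho> x) \<and> (\<forall>x \<in> Z. \<sigma> (\<gamma> x) = \<gamma> x))" ..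
  have *: "\<exists>\<sigma>. i < arity f \<longrightarrow>
      \<sigma> \<in> Aut A \<and> (\<forall>x \<in> Z. \<sigma> x = \<alpha> b i x) \<and> (\<forall>x \<in> Z. \<sigma> (\<gamma> x) = \<gamma> x)" for b i
  proof (cases "i < arity f")
    case True
    then have "\<alpha> b i ` Z \<subseteq> Y" by (auto simp: Y_def)
    with indep \<alpha>[OF True] show ?thesis by blast
  qed simp
  have "\<forall>b. \<exists>\<sigma>. \<forall>i. i < arity f \<longrightarrow>
      \<sigma> i \<in> Aut A \<and> (\<forall>x \<in> Z. \<sigma> i x = \<alpha> b i x) \<and> (\<forall>x \<in> Z. \<sigma> i (\<gamma> x) = \<gamma> x)"
    by (intro allI choice *)
  from choice[OF this] obtain \<sigma> where "\<forall>b i. i < arity f \<longrightarrow>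
      \<sigma> b i \<in> Aut A \<and> (\<forall>x \<in> Z. \<sigma> b i x = \<alpha> b i x) \<and> (\<forall>x \<in> Z. \<sigma> b i (\<gamma> x) = \<gamma> x)" ..
  then have \<sigma>: "i < arity f \<Longrightarrow>
      \<sigma> b i \<in> Aut A \<and> (\<forall>x \<in> Z. \<sigma> b i x = \<alpha> b i x) \<and> (\<forall>x \<in> Z. \<sigma> b i (\<gamma> x) = \<gamma> x)" for b i
    by blast
  define p where "p b = fam (\<sigma> b)" for b
  have Pol: "binary (p b) \<in> Pol C" for b
    unfolding p_def fam_def using \<sigma> c by (intro Pol_binary_minor[OF f]) auto
  have p_\<alpha>: "p b x y = fam (\<alpha> b) x y" if "x \<in> Z" "y \<in> Z" for b x y
  proof -
    have "\<sigma> b i ([x, y] ! c i) = \<alpha> b i ([x, y] ! c i)" if "i < arity f" for i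
      using \<sigma>[OF that] c[OF that] \<open>x \<in> Z\<close> \<open>y \<in> Z\<close> by (auto simp: less_2_cases_iff)
    then show ?thesis unfolding p_def fam_def by (intro arg_cong[of _ _ "app f"] map_cong) auto
  qed
  have p_\<gamma>: "p b (\<gamma> x) (\<gamma> y) = fam (\<lambda>_. \<gamma>) x y" if "x \<in> Z" "y \<in> Z" for b x y
  proof -
    have "\<sigma> b i ([\<gamma> x, \<gamma> y] ! c i) = \<gamma> ([x, y] ! c i)" if "i < arity f" for i
      using \<sigma>[OF that] c[OF that] \<open>x \<in> Z\<close> \<open>y \<in> Z\<close> by (auto simp: less_2_cases_iff)
    then show ?thesis unfolding p_def fam_def by (intro arg_cong[of _ _ "app f"] map_cong) auto
  qed
  obtain \<delta> \<epsilon> where \<delta>: "\<delta> \<in> Aut A" "\<delta> ` X \<subseteq> Z" and \<epsilon>: "\<epsilon> \<in> Aut A" "\<epsilon> ` X \<subseteq> Z"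
    and can: "\<forall>j. canonical_on X (\<lambda>x y. (case j of (b, t) \<Rightarrow>
      \<lambda>x y. p b (if t then \<gamma> x else x) (\<gamma> y)) (\<delta> x) (\<epsilon> y))"
    using spec[OF Z, of "\<lambda>(b, t) x y. p b (if t then \<gamma> x else x) (\<gamma> y)"] by auto
  define U where "U s t = (if t then \<gamma> else id) \<circ> (if s then \<epsilon> else \<delta>)" for s t
  have in_Z: "\<delta> x \<in> Z" "\<epsilon> x \<in> Z" if "x \<in> X" for x
    using that \<delta>(2) \<epsilon>(2) by auto
  have "U s t \<in> Aut A" for s t
    unfolding U_def using \<gamma> \<delta>(1) \<epsilon>(1) by auto
  moreover have "linked G X p U"
    unfolding linked_def
  proof (intro conjI allI ballI)
    fix b
    \<comment> \<open>moving the arguments by \<open>\<delta>\<close> and \<open>\<epsilon>\<close> does no harm, because \<open>G b\<close> is canonical\<close>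
    show "similar_on X (\<lambda>x y. p b (U False False x) (U True False y)) (G b)"
    proof -
      define W where "W = X \<union> \<delta> ` X \<union> \<epsilon> ` X"
      have "canonical_on W (G b)"
        using canonical_minor_on[OF g, of W b c] c \<open>finite X\<close> unfolding W_def G_def ar by simp
      from canonical_onD[OF this \<delta>(1) \<epsilon>(1)] obtain \<tau> where \<tau>: "\<tau> \<in> Aut A"
        "\<forall>x \<in> W. \<forall>y \<in> W. \<delta> x \<in> W \<longrightarrow> \<epsilon> y \<in> W \<longrightarrow> G b (\<delta> x) (\<epsilon> y) = \<tau> (G b x y)" ..
      have "p b (\<delta> x) (\<epsilon> y) = (inv (u b) \<circ> \<tau>) (G b x y)" if "x \<in> X" "y \<in> X" for x y
      proof -
        have "x \<in> W" "y \<in> W" "\<delta> x \<in> W" "\<epsilon> y \<in> W" using that by (auto simp: W_def)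
        then have "G b (\<delta> x) (\<epsilon> y) = \<tau> (G b x y)" using \<tau>(2) by blast
        then have "u b (p b (\<delta> x) (\<epsilon> y)) = \<tau> (G b x y)"
          using that in_Z G p_\<alpha> by simp
        then have "inv (u b) (u b (p b (\<delta> x) (\<epsilon> y))) = inv (u b) (\<tau> (G b x y))" by simp
        then show ?thesis using u[of b] by simp
      qed
      then show ?thesis
        unfolding similar_on_def U_def using u[of b] \<tau>(1)
        by (intro bexI[of _ "inv (u b) \<circ> \<tau>"]) auto
    qed
    show "canonical_on X (\<lambda>x y. p b (U False False x) (U True True y))"
      using spec[OF can, of "(b, False)"] by (simp add: U_def)
    show "canonical_on X (\<lambda>x y. p b (U False True x) (U True True y))"
      using spec[OF can, of "(b, True)"] by (simp add: U_def)
    fix x y assume "x \<in> X" "y \<in> X"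
    then show "p True (U False True x) (U True True y) = p False (U False True x) (U True True y)"
      by (simp add: U_def p_\<gamma> in_Z)
  qed
  ultimately show ?thesis using Pol by blast
qed

text \<open>
  Compactness is applied twice.  The first limit makes the unary functions global; an automorphism
  \<open>\<tau>\<close> that moves them is compensated by \<open>inv \<tau>\<close> in the arguments of \<open>p\<close>.  Once they are fixed, the
  second limit makes the polymorphisms global.
\<close>

lemma linked_limit:
  assumes approximations: "\<And>X. finite X \<Longrightarrow>
    \<exists>p U. (\<forall>b. binary (p b) \<in> Pol C) \<and> (\<forall>s t. U s t \<in> Aut A) \<and> linked G X p U"
  shows "\<exists>p U. (\<forall>b. binary (p b) \<in> Pol C) \<and> (\<forall>s t. U s t \<in> Aut_closure A) \<and>
    (\<forall>X. finite X \<longrightarrow> linked G X p U)"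
proof -
  define R :: "'a set \<Rightarrow> (bool \<times> bool \<times> 'a \<Rightarrow> 'a) \<Rightarrow> bool" where
    "R X \<phi> \<longleftrightarrow> (\<forall>s t. (\<lambda>x. \<phi> (s, t, x)) \<in> Aut A) \<and>
      (\<exists>p. (\<forall>b. binary (p b) \<in> Pol C) \<and> linked G X p (\<lambda>s t x. \<phi> (s, t, x)))" for X \<phi>
  have R: "\<exists>\<phi>. R X \<phi>" if X: "finite X" for X
  proof -
    from approximations[OF X] obtain p U where
      "\<forall>b. binary (p b) \<in> Pol C" "\<forall>s t. U s t \<in> Aut A" "linked G X p U"
      by (elim exE conjE) (rule that)
    then show ?thesis unfolding R_def by (intro exI[of _ "\<lambda>(s, t, x). U s t x"]) auto
  qed
  have R_subset: "R X \<phi>" if "R Y \<phi>" "X \<subseteq> Y" for X Y \<phi>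
    using that linked_subset unfolding R_def by blast
  have "\<exists>\<psi>. \<forall>X E. finite X \<longrightarrow> finite E \<longrightarrow> (\<exists>\<phi>. R X \<phi> \<and> (\<exists>\<tau> \<in> Aut A. \<forall>s \<in> E. \<psi> s = \<tau> (\<phi> s)))"
    by (rule compactness) (erule R, erule R_subset, assumption)
  then obtain \<psi> where \<psi>: "\<forall>X E. finite X \<longrightarrow> finite E \<longrightarrow> (\<exists>\<phi>. R X \<phi> \<and> (\<exists>\<tau> \<in> Aut A. \<forall>s \<in> E. \<psi> s = \<tau> (\<phi> s)))" ..
  define V where "V s t x = \<psi> (s, t, x)" for s t x
  have V: "V s t \<in> Aut_closure A" for s t
  proof (rule Aut_closureI)
    fix F :: "'a set" assume "finite F"
    then have "finite ((\<lambda>x. (s, t, x)) ` F)" by simp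
    from mp[OF mp[OF spec[OF spec[OF \<psi>]] finite.emptyI] this] obtain \<phi> \<tau> where
      "R {} \<phi>" "\<tau> \<in> Aut A" "\<forall>i \<in> (\<lambda>x. (s, t, x)) ` F. \<psi> i = \<tau> (\<phi> i)"
      by blast
    then show "\<exists>\<alpha> \<in> Aut A. \<forall>x \<in> F. V s t x = \<alpha> x"
      unfolding R_def V_def by (intro bexI[of _ "\<tau> \<circ> (\<lambda>x. \<phi> (s, t, x))"]) auto
  qed
  define Q :: "'a set \<Rightarrow> (bool \<times> 'a \<times> 'a \<Rightarrow> 'a) \<Rightarrow> bool" where
    "Q X \<phi> \<longleftrightarrow> (\<forall>b. binary (\<lambda>x y. \<phi> (b, x, y)) \<in> Pol C) \<and> linked G X (\<lambda>b x y. \<phi> (b, x, y)) V"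
    for X \<phi>
  have Q: "\<exists>\<phi>. Q X \<phi>" if X: "finite X" for X
  proof -
    have "finite (UNIV \<times> UNIV \<times> X :: (bool \<times> bool \<times> 'a) set)" using X by simp
    from mp[OF mp[OF spec[OF spec[OF \<psi>]] X] this] obtain \<phi> \<tau> where
      "R X \<phi>" and \<tau>: "\<tau> \<in> Aut A" "\<forall>i \<in> UNIV \<times> UNIV \<times> X. \<psi> i = \<tau> (\<phi> i)"
      by blast
    then obtain p where p: "\<forall>b. binary (p b) \<in> Pol C" "linked G X p (\<lambda>s t x. \<phi> (s, t, x))"
      unfolding R_def by blast
    have linked: "linked G X (\<lambda>b x y. p b (inv \<tau> x) (inv \<tau> y)) V"
      by (rule linked_transfer[OF p(2) Aut_id]) (use \<tau> in \<open>simp add: V_def\<close>)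
    have inv: "inv \<tau> \<in> Aut_closure A"
      by (rule Aut_closureI) (use \<tau>(1) in blast)
    have "binary (\<lambda>x y. p b (inv \<tau> x) (inv \<tau> y)) \<in> Pol C" for b
      by (rule Pol_binary_Aut_closure[OF spec[OF p(1)] inv inv])
    with linked show ?thesis
      unfolding Q_def by (intro exI[of _ "\<lambda>(b, x, y). p b (inv \<tau> x) (inv \<tau> y)"]) auto
  qed
  have Q_subset: "Q X \<phi>" if "Q Y \<phi>" "X \<subseteq> Y" for X Y \<phi>
    using that linked_subset unfolding Q_def by blast
  have "\<exists>\<theta>. \<forall>X E. finite X \<longrightarrow> finite E \<longrightarrow> (\<exists>\<phi>. Q X \<phi> \<and> (\<exists>\<tau> \<in> Aut A. \<forall>s \<in> E. \<theta> s = \<tau> (\<phi> s)))"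
    by (rule compactness) (erule Q, erule Q_subset, assumption)
  then obtain \<theta> where \<theta>: "\<forall>X E. finite X \<longrightarrow> finite E \<longrightarrow> (\<exists>\<phi>. Q X \<phi> \<and> (\<exists>\<tau> \<in> Aut A. \<forall>s \<in> E. \<theta> s = \<tau> (\<phi> s)))" ..
  have "binary (\<lambda>x y. \<theta> (b, x, y)) \<in> Pol C" for b
  proof (rule Pol_binary_locally)
    fix X :: "'a set" assume "finite X"
    then have "finite ({b} \<times> X \<times> X)" by simp
    from mp[OF mp[OF spec[OF spec[OF \<theta>]] finite.emptyI] this] obtain \<phi> \<tau> where
      "Q {} \<phi>" "\<tau> \<in> Aut A" "\<forall>i \<in> {b} \<times> X \<times> X. \<theta> i = \<tau> (\<phi> i)"
      by blast
    then show "\<exists>G \<tau>. binary G \<in> Pol C \<and> \<tau> \<in> Aut A \<and> (\<forall>x \<in> X. \<forall>y \<in> X. \<theta> (b, x, y) = \<tau> (G x y))"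
      unfolding Q_def by (intro exI[of _ "\<lambda>x y. \<phi> (b, x, y)"] exI[of _ \<tau>]) auto
  qed
  moreover have "linked G X (\<lambda>b x y. \<theta> (b, x, y)) V" if X: "finite X" for X
  proof -
    define W where "W = (\<Union>s. \<Union>t. V s t ` X)"
    have "finite (UNIV \<times> W \<times> W :: (bool \<times> 'a \<times> 'a) set)" using X by (simp add: W_def)
    from mp[OF mp[OF spec[OF spec[OF \<theta>]] X] this] obtain \<phi> \<tau> where
      \<phi>: "Q X \<phi>" and \<tau>: "\<tau> \<in> Aut A" "\<forall>i \<in> UNIV \<times> W \<times> W. \<theta> i = \<tau> (\<phi> i)"
      by blast
    have V_in_W: "V s t x \<in> W" if "x \<in> X" for s t x
      unfolding W_def using that by blast
    from \<phi> have "linked G X (\<lambda>b x y. \<phi> (b, x, y)) V" unfolding Q_def ..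
    from linked_transfer[OF this \<tau>(1)] show ?thesis
      using \<tau>(2) V_in_W by simp
  qed
  ultimately show ?thesis
    using V by (intro exI[of _ "\<lambda>b x y. \<theta> (b, x, y)"] exI[of _ V]) auto
qed

end

context ramsey_reduct
begin

section \<open>Unique interpolation\<close>

text \<open>
  If \<open>F\<close> and \<open>G\<close> agree up to an automorphism on every finite set, then compactness yields \<open>e True\<close> and
  \<open>e False\<close> in the closure with \<open>e True \<circ> F = e False \<circ> G\<close>; invariance removes the outer functions.
\<close>

lemma invariant_similar:
  assumes inv: "invariant_under (Aut_closure A) (canonical_Pol A C) \<zeta>"
    and F: "binary F \<in> canonical_Pol A C" and G: "binary G \<in> canonical_Pol A C"
    and sim: "\<And>X. finite X \<Longrightarrow> similar_on X F G"
  shows "\<zeta> (binary F) = \<zeta> (binary G)"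
proof -
  define R :: "'a set \<Rightarrow> (bool \<times> 'a \<Rightarrow> 'a) \<Rightarrow> bool" where
    "R X \<phi> \<longleftrightarrow> (\<forall>b. (\<lambda>x. \<phi> (b, x)) \<in> Aut A) \<and>
      (\<forall>x \<in> X. \<forall>y \<in> X. \<phi> (True, F x y) = \<phi> (False, G x y))" for X \<phi>
  have R: "\<exists>\<phi>. R X \<phi>" if X: "finite X" for X
  proof -
    from sim[OF X] obtain \<tau> where \<tau>: "\<tau> \<in> Aut A" "\<forall>x \<in> X. \<forall>y \<in> X. F x y = \<tau> (G x y)"
      unfolding similar_on_def ..
    have "(\<lambda>x. (if b then id else \<tau>) x) \<in> Aut A" for b using \<tau>(1) Aut_id by simp
    with \<tau>(2) show ?thesis
      unfolding R_def by (intro exI[of _ "\<lambda>(b, x). (if b then id else \<tau>) x"]) simp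
  qed
  have R_subset: "R X \<phi>" if "R Y \<phi>" "X \<subseteq> Y" for X Y \<phi>
    using that unfolding R_def by blast
  have "\<exists>\<psi>. \<forall>X E. finite X \<longrightarrow> finite E \<longrightarrow> (\<exists>\<phi>. R X \<phi> \<and> (\<exists>\<tau> \<in> Aut A. \<forall>s \<in> E. \<psi> s = \<tau> (\<phi> s)))"
    by (rule compactness) (erule R, erule R_subset, assumption)
  then obtain \<psi> where
    \<psi>: "\<forall>X E. finite X \<longrightarrow> finite E \<longrightarrow> (\<exists>\<phi>. R X \<phi> \<and> (\<exists>\<tau> \<in> Aut A. \<forall>s \<in> E. \<psi> s = \<tau> (\<phi> s)))" ..
  define e where "e b x = \<psi> (b, x)" for b x
  have e: "e b \<in> Aut_closure A" for b
  proof (rule Aut_closureI)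
    fix X :: "'a set" assume "finite X"
    then have "finite ({b} \<times> X)" by simp
    from mp[OF mp[OF spec[OF spec[OF \<psi>]] finite.emptyI] this] obtain \<phi> \<tau> where
      "R {} \<phi>" "\<tau> \<in> Aut A" "\<forall>i \<in> {b} \<times> X. \<psi> i = \<tau> (\<phi> i)"
      by blast
    then show "\<exists>\<alpha> \<in> Aut A. \<forall>x \<in> X. e b x = \<alpha> x"
      unfolding R_def e_def by (intro bexI[of _ "\<tau> \<circ> (\<lambda>x. \<phi> (b, x))"]) auto
  qed
  have eq: "e True (F x y) = e False (G x y)" for x y
  proof -
    have "finite {x, y}" "finite {(True, F x y), (False, G x y)}" by simp_all
    from mp[OF mp[OF spec[OF spec[OF \<psi>]] this(1)] this(2)] obtain \<phi> \<tau> where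
      "R {x, y} \<phi>" "\<forall>i \<in> {(True, F x y), (False, G x y)}. \<psi> i = \<tau> (\<phi> i)"
      by blast
    then show ?thesis by (simp add: R_def e_def)
  qed
  have outer: "\<zeta> (binary H) = \<zeta> (binary (\<lambda>x y. e b (H x y)))"
    if "binary H \<in> canonical_Pol A C" for H b
  proof -
    have "[id, id] \<in> tuples (arity (binary H)) (Aut_closure A)"
      using id_in_Aut_closure by (simp add: tuples_def)
    with inv that e[of b]
    have "\<zeta> (binary H) = \<zeta> (outer (e b) (inner (binary H) [id, id]))"
      unfolding invariant_under_def by blast
    then show ?thesis by (simp add: outer_inner_binary)
  qed
  show ?thesis
    using outer[OF F, of True] outer[OF G, of False] by (simp add: eq)
qed

lemma canonical_Pol_binary:
  assumes "binary F \<in> Pol C" and "\<And>X. finite X \<Longrightarrow> canonical_on X F"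
  shows "binary F \<in> canonical_Pol A C"
  using assms canonical_binaryI by (simp add: canonical_Pol_def)

definition argument_independent :: "('a operation \<Rightarrow> 'b) \<Rightarrow> bool" where
  "argument_independent \<zeta> \<longleftrightarrow> (\<forall>f \<in> Pol C. \<forall>u\<^sub>1 \<in> Aut_closure A. \<forall>u\<^sub>2 \<in> Aut_closure A.
     arity f = 2 \<and> canonical A (inner f [id, u\<^sub>1]) \<and> canonical A (inner f [id, u\<^sub>2]) \<longrightarrow>
     \<zeta> (inner f [id, u\<^sub>1]) = \<zeta> (inner f [id, u\<^sub>2]))"

lemma argument_independent_second:
  assumes "argument_independent \<zeta>" and F: "binary F \<in> Pol C" and u: "u \<in> Aut_closure A"
    and v: "v \<in> Aut_closure A" and w: "w \<in> Aut_closure A"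
    and can: "\<And>X. finite X \<Longrightarrow> canonical_on X (\<lambda>x y. F (u x) (v y))"
      "\<And>X. finite X \<Longrightarrow> canonical_on X (\<lambda>x y. F (u x) (w y))"
  shows "\<zeta> (binary (\<lambda>x y. F (u x) (v y))) = \<zeta> (binary (\<lambda>x y. F (u x) (w y)))"
proof -
  let ?f = "binary (\<lambda>x y. F (u x) y)"
  have inner: "inner ?f [id, t] = binary (\<lambda>x y. F (u x) (t y))" for t
    by (simp add: inner_binary)
  have "?f \<in> Pol C"
    using Pol_binary_Aut_closure[OF F u id_in_Aut_closure] by simp
  moreover have "canonical A (inner ?f [id, v])" "canonical A (inner ?f [id, w])"
    unfolding inner by (rule canonical_binaryI, erule can)+
  then have "arity ?f = 2 \<and> canonical A (inner ?f [id, v]) \<and> canonical A (inner ?f [id, w])"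
    by simp
  ultimately have "\<zeta> (inner ?f [id, v]) = \<zeta> (inner ?f [id, w])"
    using assms(1) v w unfolding argument_independent_def by blast
  then show ?thesis by (simp only: inner)
qed

text \<open>
  The path from \<open>F(u, v)\<close> over \<open>F(u, v')\<close> to \<open>F(u', v')\<close>.  The second step changes the first argument,
  so it is carried out for the operation with exchanged arguments.
\<close>

lemma argument_independent_both:
  assumes ind: "argument_independent \<zeta>" and minor: "minor_preserving (canonical_Pol A C) \<zeta>"
    and F: "binary F \<in> Pol C"
    and u: "u \<in> Aut_closure A" "u' \<in> Aut_closure A" and v: "v \<in> Aut_closure A" "v' \<in> Aut_closure A"
    and can: "\<And>X. finite X \<Longrightarrow> canonical_on X (\<lambda>x y. F (u x) (v y))"
      "\<And>X. finite X \<Longrightarrow> canonical_on X (\<lambda>x y. F (u x) (v' y))"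
      "\<And>X. finite X \<Longrightarrow> canonical_on X (\<lambda>x y. F (u' x) (v' y))"
  shows "\<zeta> (binary (\<lambda>x y. F (u x) (v y))) = \<zeta> (binary (\<lambda>x y. F (u' x) (v' y)))"
proof -
  have swap: "\<zeta> (binary (\<lambda>x y. F (t x) (v' y))) = minor (\<zeta> (binary (\<lambda>x y. F (t y) (v' x)))) 2 (\<lambda>i. 1 - i)"
    if t: "t \<in> Aut_closure A" and "\<And>X. finite X \<Longrightarrow> canonical_on X (\<lambda>x y. F (t x) (v' y))" for t
  proof -
    have "binary (\<lambda>x y. F (t y) (v' x)) \<in> canonical_Pol A C"
      using that Pol_binary_Aut_closure[OF F t v(2)]
      by (intro canonical_Pol_binary canonical_on_swap[of _ "\<lambda>x y. F (t x) (v' y)"]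
          Pol_binary_swap[of "\<lambda>x y. F (t x) (v' y)"])
    moreover have "(\<lambda>i. 1 - i) \<in> {..<2} \<rightarrow> {..<2::nat}" by auto
    ultimately have "\<zeta> (minor (binary (\<lambda>x y. F (t y) (v' x))) 2 (\<lambda>i. 1 - i)) =
        minor (\<zeta> (binary (\<lambda>x y. F (t y) (v' x)))) 2 (\<lambda>i. 1 - i)"
      using minor unfolding minor_preserving_def by (metis arity_binary)
    then show ?thesis by (simp only: minor_binary_swap)
  qed
  have "\<zeta> (binary (\<lambda>x y. F (u x) (v y))) = \<zeta> (binary (\<lambda>x y. F (u x) (v' y)))"
    by (rule argument_independent_second[OF ind F u(1) v can(1,2)])
  also have "\<zeta> (binary (\<lambda>x y. F (u y) (v' x))) = \<zeta> (binary (\<lambda>x y. F (u' y) (v' x)))"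
    by (rule argument_independent_second[OF ind Pol_binary_swap[OF F] v(2) u
          canonical_on_swap[OF can(2)] canonical_on_swap[OF can(3)]])
  then have "\<zeta> (binary (\<lambda>x y. F (u x) (v' y))) = \<zeta> (binary (\<lambda>x y. F (u' x) (v' y)))"
    using swap[OF u(1) can(2)] swap[OF u(2) can(3)] by simp
  finally show ?thesis .
qed

lemma argument_independent_minor:
  assumes inv: "invariant_under (Aut_closure A) (canonical_Pol A C) \<zeta>"
    and minor: "minor_preserving (canonical_Pol A C) \<zeta>"
    and ind: "argument_independent \<zeta>"
    and f: "f \<in> Pol C" and g: "\<And>b. g b \<in> canonical_Pol A C"
    and interp: "\<And>b. interpolates (Aut A) f (g b)"
    and c: "\<And>i. i < arity f \<Longrightarrow> c i < 2"
  shows "minor (\<zeta> (g True)) 2 c = minor (\<zeta> (g False)) 2 c"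
proof -
  define G where "G b x y = app (g b) (map (\<lambda>i. [x, y] ! c i) [0..<arity f])" for b x y
  have ar: "arity (g b) = arity f" for b
    using interp[of b] by (simp add: interpolates_def)
  have can: "canonical A (g b)" for b using g by (simp add: canonical_Pol_def)
  have can_G: "canonical_on X (G b)" if "finite X" for X b
    using canonical_minor_on[OF can that, of b c] c unfolding G_def ar by simp
  have minor_G: "minor (g b) 2 c = binary (G b)" for b
    unfolding minor_def binary_def G_def ar
    by (rule mk_op_cong) (auto simp: length_2_conv)
  have "g b \<in> Pol C" for b using g by (simp add: canonical_Pol_def)
  then have Pol_G: "binary (G b) \<in> Pol C" for b
    using Pol_binary_minor[of "g b" "\<lambda>_. id" c] c unfolding G_def ar by simp
  have "\<exists>p U. (\<forall>b. binary (p b) \<in> Pol C) \<and> (\<forall>s t. U s t \<in> Aut_closure A) \<and>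
      (\<forall>X. finite X \<longrightarrow> linked G X p U)"
  proof (rule linked_limit)
    fix X :: "'a set" assume "finite X"
    have "G = (\<lambda>b x y. app (g b) (map (\<lambda>i. [x, y] ! c i) [0..<arity f]))"
      by (intro ext) (rule G_def)
    then show "\<exists>p U. (\<forall>b. binary (p b) \<in> Pol C) \<and> (\<forall>s t. U s t \<in> Aut A) \<and> linked G X p U"
      using linked_on_finite[of f g c X, OF f can interp _ \<open>finite X\<close>] c by simp
  qed
  then obtain p U where "\<forall>b. binary (p b) \<in> Pol C" "\<forall>s t. U s t \<in> Aut_closure A"
    "\<forall>X. finite X \<longrightarrow> linked G X p U"
    by (elim exE conjE) (rule that)
  then have p: "binary (p b) \<in> Pol C" and U: "U s t \<in> Aut_closure A"
    and l: "finite X \<Longrightarrow> linked G X p U" for b s t X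
    by blast+
  have can_p: "canonical_on X (\<lambda>x y. p b (U False False x) (U True False y))"
    "canonical_on X (\<lambda>x y. p b (U False False x) (U True True y))"
    "canonical_on X (\<lambda>x y. p b (U False True x) (U True True y))"
    and sim: "similar_on X (\<lambda>x y. p b (U False False x) (U True False y)) (G b)"
    if X: "finite X" for X b
    using l[OF X] canonical_on_similar[OF _ can_G[OF X]] by (auto simp: linked_def)
  have "\<zeta> (binary (G b)) = \<zeta> (binary (\<lambda>x y. p b (U False True x) (U True True y)))" for b
  proof -
    have "\<zeta> (binary (\<lambda>x y. p b (U False False x) (U True False y))) = \<zeta> (binary (G b))"
      by (rule invariant_similar[OF inv _ _ sim])
        (auto intro!: canonical_Pol_binary can_p can_G Pol_G Pol_binary_Aut_closure p U)
    also have "\<zeta> (binary (\<lambda>x y. p b (U False False x) (U True False y))) =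
        \<zeta> (binary (\<lambda>x y. p b (U False True x) (U True True y)))"
      by (rule argument_independent_both[OF ind minor p U U U U can_p])
    finally show ?thesis by simp
  qed
  moreover have "p True (U False True x) (U True True y) = p False (U False True x) (U True True y)" for x y
    using l[of "{x, y}"] by (simp add: linked_def)
  ultimately have "\<zeta> (binary (G True)) = \<zeta> (binary (G False))" by simp
  moreover have "\<zeta> (binary (G b)) = minor (\<zeta> (g b)) 2 c" for b
  proof -
    have "c \<in> {..<arity (g b)} \<rightarrow> {..<2}" using c by (auto simp: ar)
    then show ?thesis
      using minor g[of b] unfolding minor_preserving_def minor_G[symmetric] by blast
  qed
  ultimately show ?thesis by simp
qed

text \<open>
  For projections to the positions \<open>i\<close> and \<open>j\<close>, the partition into \<open>{i}\<close> and its complement already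
  separates \<open>i\<close> from \<open>j\<close>.
\<close>

lemma argument_independent_imp_UIP:
  assumes "\<zeta> \<in> canonical_Pol A C \<rightarrow> Proj"
    and "invariant_under (Aut_closure A) (canonical_Pol A C) \<zeta>"
    and "minor_preserving (canonical_Pol A C) \<zeta>"
    and "argument_independent \<zeta>"
  shows "UIP A (Pol C) (canonical_Pol A C) \<zeta>"
  unfolding UIP_def
proof (intro ballI impI)
  fix g h f assume g: "g \<in> canonical_Pol A C" and h: "h \<in> canonical_Pol A C" and f: "f \<in> Pol C"
    and interp: "interpolates (Aut A) f g \<and> interpolates (Aut A) f h"
  let ?k = "arity f"
  have "arity (\<zeta> g) = ?k" "arity (\<zeta> h) = ?k"
    using interp g h assms(3) by (auto simp: interpolates_def minor_preserving_def)
  moreover from funcset_mem[OF assms(1)] g h obtain m n i j where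
    "\<zeta> g = mk_op m (\<lambda>xs. xs ! i)" "i < m" "\<zeta> h = mk_op n (\<lambda>xs. xs ! j)" "j < n"
    unfolding Proj_def by blast
  ultimately have i: "i < ?k" "\<zeta> g = mk_op ?k (\<lambda>xs. xs ! i)"
    and j: "j < ?k" "\<zeta> h = mk_op ?k (\<lambda>xs. xs ! j)" by simp_all
  define c :: "nat \<Rightarrow> nat" where "c l = (if l = i then 0 else 1)" for l
  have "minor (\<zeta> g) 2 c = minor (\<zeta> h) 2 c"
    using argument_independent_minor[OF assms(2-4) f, of "\<lambda>b. if b then g else h" c]
      g h interp by (simp add: c_def)
  then have "app (minor (\<zeta> g) 2 c) [True, False] = app (minor (\<zeta> h) 2 c) [True, False]" by simp
  then have "[True, False] ! c i = [True, False] ! c j"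
    using i j by (simp add: minor_def)
  then have "i = j" by (simp add: c_def split: if_splits)
  then show "\<zeta> g = \<zeta> h" using i j by simp
qed

lemma UIP_imp_argument_independent:
  assumes "UIP A (Pol C) (canonical_Pol A C) \<zeta>"
  shows "argument_independent \<zeta>"
  unfolding argument_independent_def
proof (intro ballI impI)
  fix f u1 u2 assume f: "f \<in> Pol C" and u: "u1 \<in> Aut_closure A" "u2 \<in> Aut_closure A"
    and *: "arity f = 2 \<and> canonical A (inner f [id, u1]) \<and> canonical A (inner f [id, u2])"
  have "app f \<in> extensional (tuples 2 UNIV)"
    using f * by (auto simp: Pol_def homs_def power_struct_def PiE_def)
  then have "f = binary (\<lambda>x y. app f [x, y])"
    using * by (auto simp: binary_def mk_op_def prod_eq_iff fun_eq_iff extensional_def tuples_def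
        restrict_def length_2_conv)
  then obtain F where F: "f = binary F" ..
  have "inner f [id, u] \<in> Pol C" "interpolates (Aut A) f (inner f [id, u])"
    if u: "u \<in> Aut_closure A" for u
  proof -
    have inner: "inner f [id, u] = binary (\<lambda>x y. F x (u y))"
      by (simp add: F inner_binary)
    show "inner f [id, u] \<in> Pol C"
      using Pol_binary_Aut_closure[OF f[unfolded F] id_in_Aut_closure u] by (simp add: inner)
    show "interpolates (Aut A) f (inner f [id, u])"
      unfolding interpolates_def
    proof (intro conjI allI impI)
      fix X :: "'a set" assume "finite X"
      from Aut_closureD[OF u this] obtain \<alpha> where \<alpha>: "\<alpha> \<in> Aut A" "\<forall>x \<in> X. u x = \<alpha> x" ..
      have "[id, \<alpha>] \<in> tuples (arity f) (Aut A)" using \<alpha>(1) by (simp add: F tuples_def)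
      moreover have "\<forall>xs \<in> tuples (arity f) X.
          app (inner f [id, u]) xs = id (app f (map2 (\<lambda>v x. v x) [id, \<alpha>] xs))"
        unfolding inner unfolding F using \<alpha>(2) by (auto simp: tuples_def length_2_conv binary_def)
      ultimately show "\<exists>e \<in> Aut A. \<exists>vs \<in> tuples (arity f) (Aut A). \<forall>xs \<in> tuples (arity f) X.
          app (inner f [id, u]) xs = e (app f (map2 (\<lambda>v x. v x) vs xs))"
        using Aut_id by blast
    qed (simp add: F inner_binary)
  qed
  then show "\<zeta> (inner f [id, u1]) = \<zeta> (inner f [id, u2])"
    using assms f u * unfolding UIP_def canonical_Pol_def by blast
qed

end

theorem theorem6p3:
  fixes A :: "('r, 'a::countable) struct"
    and C :: "('s, 'a) struct"
    and \<zeta> :: "'a operation \<Rightarrow> bool operation"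
  assumes "univ A = UNIV"
    and "finitely_homogeneous A"
    and "ramsey A"
    and "reduct C A"
    and "\<zeta> \<in> canonical_Pol A C \<rightarrow> Proj"
    and "invariant_under (Aut_closure A) (canonical_Pol A C) \<zeta>"
    and "minor_preserving (canonical_Pol A C) \<zeta>"
  shows "UIP A (Pol C) (canonical_Pol A C) \<zeta> \<longleftrightarrow>
    (\<forall>f \<in> Pol C. \<forall>u\<^sub>1 \<in> Aut_closure A. \<forall>u\<^sub>2 \<in> Aut_closure A.
       arity f = 2 \<and> canonical A (inner f [id, u\<^sub>1]) \<and> canonical A (inner f [id, u\<^sub>2]) \<longrightarrow>
       \<zeta> (inner f [id, u\<^sub>1]) = \<zeta> (inner f [id, u\<^sub>2]))"
proof -
  interpret ramsey_reduct A C
    using assms(1-4) by unfold_locales (simp_all add: finitely_homogeneous_def)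
  show ?thesis
    unfolding argument_independent_def[symmetric]
    using argument_independent_imp_UIP[OF assms(5-7)] UIP_imp_argument_independent by blast
qed

end
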